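(* Let $\mathcal A$ and $\mathfrak A$ be Banach algebras such that $\mathcal A$ is a Banach $\mathfrak A$-bimodule with compatible actions. Let $n\in\mathbb N$ and let $D:\mathcal A\rtimes\mathfrak A\to(\mathcal A\rtimes\mathfrak A)^{(2n+1)}$ be a derivation, with components $D^1_{\mathcal A}:\mathcal A\to\mathcal A^{(2n+1)}$, $D^2_{\mathcal A}:\mathcal A\to\mathfrak A^{(2n+1)}$, $D^1_{\mathfrak A}:\mathfrak A\to\mathcal A^{(2n+1)}$, $D^2_{\mathfrak A}:\mathfrak A\to\mathfrak A^{(2n+1)}$ determined by $D((a,\beta))=(D^1_{\mathcal A}(a)+D^1_{\mathfrak A}(\beta),\ D^2_{\mathcal A}(a)+D^2_{\mathfrak A}(\beta))$. If $a^{(2n+1)}\in\mathcal A^{(2n+1)}$ and $\beta^{(2n+1)}\in\mathfrak A^{(2n+1)}$, then $D=\mathrm{ad}_{(a^{(2n+1)},\beta^{(2n+1)})}$ if and only if $D^1_{\mathcal A}=\mathrm{ad}_{a^{(2n+1)}}$ (on $\mathcal A$), $D^2_{\mathfrak A}=\mathrm{ad}_{\beta^{(2n+1)}}$, $D^1_{\mathfrak A}=\mathrm{ad}_{a^{(2n+1)}}$ (on $\mathfrak A$) and $$D^2_{\mathcal A}(a)=a\blacktriangle a^{(2n+1)}-a^{(2n+1)}\bullet a\qquad\text{for all }a\in\mathcal A.$$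
   Context: The actions of $\mathfrak A$ on $\mathcal A$ are compatible if for all $a,b\in\mathcal A$ and $\beta\in\mathfrak A$: $\beta\cdot(ab)=(\beta\cdot a)b$, $(ab)\cdot\beta=a(b\cdot\beta)$, $a(\beta\cdot b)=(a\cdot\beta)b$. The amalgamated duplication $\mathcal A\rtimes\mathfrak A$ is $\mathcal A\times\mathfrak A$ with product $(a,\beta)(b,\gamma)=(ab+a\cdot\gamma+\beta\cdot b,\ \beta\gamma)$ and norm $\|(a,\beta)\|=\|a\|+\|\beta\|$. $\mathcal Y^{(k)}$ is the $k$-th dual of a Banach space $\mathcal Y$ ($\mathcal Y^{(0)}=\mathcal Y$), and $(\mathcal A\rtimes\mathfrak A)^{(k)}$ is identified with $\mathcal A^{(k)}\times\mathfrak A^{(k)}$ via the coordinatewise pairing. If $\mathcal X$ is a Banach $\mathcal C$-bimodule, its dual is one via $\langle x^{(1)}\cdot c,x\rangle=\langle x^{(1)},c\cdot x\rangle$, $\langle c\cdot x^{(1)},x\rangle=\langle x^{(1)},x\cdot c\rangle$; iterating gives the bimodule structure on every $\mathcal X^{(k)}$. In particular $\mathcal A^{(k)}$ is both an $\mathcal A$-bimodule and an $\mathfrak A$-bimodule, and $\mathfrak A^{(k)}$ is an $\mathfrak A$-bimodule. Mixed operations: for $a\in\mathcal A$, $y\in\mathfrak A^{(2m)}$ the elements $a\blacktriangle y,\ y\bullet a\in\mathcal A^{(2m)}$ and for $x\in\mathcal A^{(2m+1)}$ the elements $a\blacktriangle x,\ x\bullet a\in\mathfrak A^{(2m+1)}$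 are defined recursively by: for $m=0$, $a\blacktriangle y=a\cdot y$ and $y\bullet a=y\cdot a$; $\langle a\blacktriangle x,y\rangle=\langle x,y\bullet a\rangle$ and $\langle x\bullet a,y\rangle=\langle x,a\blacktriangle y\rangle$ for $x\in\mathcal A^{(2m+1)}$, $y\in\mathfrak A^{(2m)}$; $\langle a\blacktriangle y,x\rangle=\langle y,x\bullet a\rangle$ and $\langle y\bullet a,x\rangle=\langle y,a\blacktriangle x\rangle$ for $y\in\mathfrak A^{(2m+2)}$, $x\in\mathcal A^{(2m+1)}$. A derivation from a Banach algebra $\mathcal C$ into a Banach $\mathcal C$-bimodule $\mathcal X$ is a continuous linear map $D$ with $D(c_1c_2)=D(c_1)\cdot c_2+c_1\cdot D(c_2)$; for $x\in\mathcal X$, $\mathrm{ad}_x:\mathcal C\to\mathcal X$ is $\mathrm{ad}_x(c)=c\cdot x-x\cdot c$. For $x\in\mathcal A^{(2n+1)}$, $\mathrm{ad}_x$ on $\mathcal A$ uses the $\mathcal A$-bimodule structure and $\mathrm{ad}_x$ on $\mathfrak A$ uses the $\mathfrak A$-bimodule structure of $\mathcal A^{(2n+1)}$. *)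

theory Defs
  imports "HOL-Analysis.Analysis" "HOL-Library.Function_Algebras"
begin

text \<open>
  Scalars range over a type \<open>'k\<close> of class \<open>real_normed_field\<close>; by the Gelfand-Mazur theorem this means
  the real or the complex numbers. A Banach algebra over \<open>'k\<close> is a type in
  \<open>real_normed_algebra\<close> and \<open>banach\<close> together with a scalar multiplication by \<open>'k\<close> that extends
  the real one.
\<close>

definition normed_algebra_scale ::
    "('k::real_normed_field \<Rightarrow> 'a::real_normed_algebra \<Rightarrow> 'a) \<Rightarrow> bool" where
  "normed_algebra_scale s \<longleftrightarrow> vector_space s
     \<and> (\<forall>t x. s (of_real t) x = t *\<^sub>R x)
     \<and> (\<forall>c x. norm (s c x) = norm c * norm x)
     \<and> (\<forall>c x y. s c x * y = s c (x * y) \<and> x * s c y = s c (x * y))"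

text \<open>The module actions are only required to be bounded, not contractive.\<close>

definition banach_bimodule ::
    "('k::real_normed_field \<Rightarrow> 'b::real_normed_algebra \<Rightarrow> 'b) \<Rightarrow> ('k \<Rightarrow> 'a::real_normed_vector \<Rightarrow> 'a)
      \<Rightarrow> ('b \<Rightarrow> 'a \<Rightarrow> 'a) \<Rightarrow> ('a \<Rightarrow> 'b \<Rightarrow> 'a) \<Rightarrow> bool" where
  "banach_bimodule sB sA l r \<longleftrightarrow> bounded_bilinear l \<and> bounded_bilinear r
     \<and> (\<forall>c \<beta> x. l (sB c \<beta>) x = sA c (l \<beta> x) \<and> l \<beta> (sA c x) = sA c (l \<beta> x))
     \<and> (\<forall>c \<beta> x. r x (sB c \<beta>) = sA c (r x \<beta>) \<and> r (sA c x) \<beta> = sA c (r x \<beta>))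
     \<and> (\<forall>\<beta> \<gamma> x. l (\<beta> * \<gamma>) x = l \<beta> (l \<gamma> x))
     \<and> (\<forall>\<beta> \<gamma> x. r x (\<beta> * \<gamma>) = r (r x \<beta>) \<gamma>)
     \<and> (\<forall>\<beta> \<gamma> x. r (l \<beta> x) \<gamma> = l \<beta> (r x \<gamma>))"

definition compatible_actions ::
    "('b \<Rightarrow> 'a::times \<Rightarrow> 'a) \<Rightarrow> ('a \<Rightarrow> 'b \<Rightarrow> 'a) \<Rightarrow> bool" where
  "compatible_actions l r \<longleftrightarrow>
     (\<forall>a b \<beta>. l \<beta> (a * b) = l \<beta> a * b \<and> r (a * b) \<beta> = a * r b \<beta> \<and> a * l \<beta> b = r a \<beta> * b)"

definition amalg_mult ::
    "('b \<Rightarrow> 'a \<Rightarrow> 'a) \<Rightarrow> ('a \<Rightarrow> 'b \<Rightarrow> 'a) \<Rightarrow> 'a::ring \<times> 'b::ring \<Rightarrow> 'a \<times> 'b \<Rightarrow> 'a \<times> 'b" where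
  "amalg_mult l r = (\<lambda>(a, \<beta>) (b, \<gamma>). (a * b + r a \<gamma> + l \<beta> b, \<beta> * \<gamma>))"

definition amalg_norm :: "'a::real_normed_vector \<times> 'b::real_normed_vector \<Rightarrow> real" where
  "amalg_norm = (\<lambda>(a, \<beta>). norm a + norm \<beta>)"

definition prod_scale :: "('k \<Rightarrow> 'a \<Rightarrow> 'a) \<Rightarrow> ('k \<Rightarrow> 'b \<Rightarrow> 'b) \<Rightarrow> 'k \<Rightarrow> 'a \<times> 'b \<Rightarrow> 'a \<times> 'b" where
  "prod_scale s t c = map_prod (s c) (t c)"


subsection \<open>Iterated duals\<close>

text \<open>
  The \<open>k\<close>-th dual of a type is a type depending on \<open>k\<close>, so it cannot be used when \<open>k\<close> is a variable.
  Instead, the duals of orders \<open>0, ..., N\<close> of a normed space \<open>'v\<close> are given as subspaces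
  \<open>lev T 0, ..., lev T N\<close> of one vector space \<open>'x\<close>. Here \<open>lev T 0\<close> is a copy of \<open>'v\<close> under
  \<open>emb T\<close>, and \<open>pair T k f x\<close> is the duality pairing of \<open>f \<in> lev T (Suc k)\<close> with \<open>x \<in> lev T k\<close>.
  Through it \<open>lev T (Suc k)\<close> is the space of all bounded linear functionals on \<open>lev T k\<close>. The order
  \<open>N\<close> is finite because one HOL type cannot in general hold the duals of all orders; that every
  order is reached, in a suitable type \<open>'x\<close>, follows from \<open>is_dual_tower_0\<close> and
  \<open>is_dual_tower_Suc\<close> below.
\<close>

record ('v, 'x, 'k) tower =
  emb :: "'v \<Rightarrow> 'x"
  lev :: "nat \<Rightarrow> 'x set"
  pair :: "nat \<Rightarrow> 'x \<Rightarrow> 'x \<Rightarrow> 'k"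

text \<open>The norm on level \<open>k\<close>: the given norm for \<open>k = 0\<close>, then successively the dual norms.\<close>

primrec level_norm ::
    "('v \<Rightarrow> real) \<Rightarrow> ('v, 'x, 'k::real_normed_field) tower \<Rightarrow> nat \<Rightarrow> 'x \<Rightarrow> real" where
  "level_norm nrm T 0 x = nrm (inv (emb T) x)"
| "level_norm nrm T (Suc k) f =
     (SUP x \<in> {x \<in> lev T k. level_norm nrm T k x \<le> 1}. norm (pair T k f x))"

definition bounded_functional ::
    "('k::real_normed_field \<Rightarrow> 'x::ab_group_add \<Rightarrow> 'x) \<Rightarrow> 'x set \<Rightarrow> ('x \<Rightarrow> real) \<Rightarrow> ('x \<Rightarrow> 'k) \<Rightarrow> bool" where
  "bounded_functional s V nrm \<phi> \<longleftrightarrow>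
     (\<forall>x\<in>V. \<forall>y\<in>V. \<phi> (x + y) = \<phi> x + \<phi> y) \<and> (\<forall>c. \<forall>x\<in>V. \<phi> (s c x) = c * \<phi> x)
     \<and> (\<exists>M. \<forall>x\<in>V. norm (\<phi> x) \<le> M * nrm x)"

definition is_dual_tower ::
    "('k::real_normed_field \<Rightarrow> 'v::ab_group_add \<Rightarrow> 'v) \<Rightarrow> ('v \<Rightarrow> real) \<Rightarrow> ('k \<Rightarrow> 'x::ab_group_add \<Rightarrow> 'x)
      \<Rightarrow> nat \<Rightarrow> ('v, 'x, 'k) tower \<Rightarrow> bool" where
  "is_dual_tower sV nrm sX N T \<longleftrightarrow>
     Vector_Spaces.linear sV sX (emb T) \<and> inj (emb T) \<and> lev T 0 = range (emb T)
     \<and> (\<forall>k<N. module.subspace sX (lev T (Suc k))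
        \<and> (\<forall>f\<in>lev T (Suc k). \<forall>g\<in>lev T (Suc k). \<forall>x\<in>lev T k.
              pair T k (f + g) x = pair T k f x + pair T k g x)
        \<and> (\<forall>c. \<forall>f\<in>lev T (Suc k). \<forall>x\<in>lev T k. pair T k (sX c f) x = c * pair T k f x)
        \<and> (\<forall>f\<in>lev T (Suc k). bounded_functional sX (lev T k) (level_norm nrm T k) (pair T k f))
        \<and> (\<forall>\<phi>. bounded_functional sX (lev T k) (level_norm nrm T k) \<phi>
              \<longrightarrow> (\<exists>!f. f \<in> lev T (Suc k) \<and> (\<forall>x\<in>lev T k. pair T k f x = \<phi> x))))"

definition functional :: "('v, 'x, 'k) tower \<Rightarrow> nat \<Rightarrow> ('x \<Rightarrow> 'k) \<Rightarrow> 'x" where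
  "functional T k \<phi> = (THE f. f \<in> lev T (Suc k) \<and> (\<forall>x\<in>lev T k. pair T k f x = \<phi> x))"

text \<open>The bimodule structure on all levels induced by actions \<open>l\<close>, \<open>r\<close> of an algebra \<open>'c\<close> on \<open>'v\<close>.\<close>

fun lact :: "('v, 'x, 'k) tower \<Rightarrow> ('c \<Rightarrow> 'v \<Rightarrow> 'v) \<Rightarrow> ('v \<Rightarrow> 'c \<Rightarrow> 'v) \<Rightarrow> nat \<Rightarrow> 'c \<Rightarrow> 'x \<Rightarrow> 'x"
and ract :: "('v, 'x, 'k) tower \<Rightarrow> ('c \<Rightarrow> 'v \<Rightarrow> 'v) \<Rightarrow> ('v \<Rightarrow> 'c \<Rightarrow> 'v) \<Rightarrow> nat \<Rightarrow> 'x \<Rightarrow> 'c \<Rightarrow> 'x" where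
  "lact T l r 0 c x = emb T (l c (inv (emb T) x))"
| "lact T l r (Suc k) c f = functional T k (\<lambda>x. pair T k f (ract T l r k x c))"
| "ract T l r 0 x c = emb T (r (inv (emb T) x) c)"
| "ract T l r (Suc k) f c = functional T k (\<lambda>x. pair T k f (lact T l r k c x))"

text \<open>The coordinatewise pairing; see \<open>is_dual_tower_prod\<close> below.\<close>

definition prod_tower ::
    "('v, 'x, 'k::plus) tower \<Rightarrow> ('w, 'y, 'k) tower \<Rightarrow> ('v \<times> 'w, 'x \<times> 'y, 'k) tower" where
  "prod_tower S T = \<lparr>emb = map_prod (emb S) (emb T), lev = (\<lambda>k. lev S k \<times> lev T k),
     pair = (\<lambda>k f x. pair S k (fst f) (fst x) + pair T k (snd f) (snd x))\<rparr>"


subsection \<open>Mixed operations\<close>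

text \<open>
  \<open>TA\<close>, \<open>TB\<close> are towers of duals of \<open>'a\<close>, \<open>'b\<close>, where \<open>'b\<close> acts on \<open>'a\<close> by \<open>l\<close> and \<open>r\<close>. The
  triangle operation is \<open>tri_even\<close>, \<open>tri_odd\<close> and the bullet operation is \<open>bul_even\<close>, \<open>bul_odd\<close>:
  the even versions at \<open>m\<close> map the \<open>2m\<close>-th dual of \<open>'b\<close> to that of \<open>'a\<close>, and the odd versions at
  \<open>m\<close> map the \<open>(2m+1)\<close>-st dual of \<open>'a\<close> to that of \<open>'b\<close>.
\<close>

fun tri_even :: "('a, 'x, 'k) tower \<Rightarrow> ('b, 'y, 'k) tower \<Rightarrow> ('a \<Rightarrow> 'b \<Rightarrow> 'a) \<Rightarrow> nat \<Rightarrow> 'a \<Rightarrow> 'y \<Rightarrow> 'x"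
and bul_odd :: "('a, 'x, 'k) tower \<Rightarrow> ('b, 'y, 'k) tower \<Rightarrow> ('a \<Rightarrow> 'b \<Rightarrow> 'a) \<Rightarrow> nat \<Rightarrow> 'x \<Rightarrow> 'a \<Rightarrow> 'y" where
  "tri_even TA TB r 0 a y = emb TA (r a (inv (emb TB) y))"
| "tri_even TA TB r (Suc m) a y =
     functional TA (2 * m + 1) (\<lambda>x. pair TB (2 * m + 1) y (bul_odd TA TB r m x a))"
| "bul_odd TA TB r m x a = functional TB (2 * m) (\<lambda>y. pair TA (2 * m) x (tri_even TA TB r m a y))"

fun bul_even :: "('a, 'x, 'k) tower \<Rightarrow> ('b, 'y, 'k) tower \<Rightarrow> ('b \<Rightarrow> 'a \<Rightarrow> 'a) \<Rightarrow> nat \<Rightarrow> 'y \<Rightarrow> 'a \<Rightarrow> 'x"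
and tri_odd :: "('a, 'x, 'k) tower \<Rightarrow> ('b, 'y, 'k) tower \<Rightarrow> ('b \<Rightarrow> 'a \<Rightarrow> 'a) \<Rightarrow> nat \<Rightarrow> 'a \<Rightarrow> 'x \<Rightarrow> 'y" where
  "bul_even TA TB l 0 y a = emb TA (l (inv (emb TB) y) a)"
| "bul_even TA TB l (Suc m) y a =
     functional TA (2 * m + 1) (\<lambda>x. pair TB (2 * m + 1) y (tri_odd TA TB l m a x))"
| "tri_odd TA TB l m a x = functional TB (2 * m) (\<lambda>y. pair TA (2 * m) x (bul_even TA TB l m y a))"


subsection \<open>Derivations\<close>

text \<open>
  \<open>'c\<close> carries a multiplication \<open>mul\<close> and a norm \<open>nC\<close>, and the bimodule is the set \<open>X\<close> with norm
  \<open>nX\<close> and actions \<open>l\<close>, \<open>r\<close>. Continuity is expressed as boundedness.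
\<close>

definition derivation ::
    "('k::field \<Rightarrow> 'c::ab_group_add \<Rightarrow> 'c) \<Rightarrow> ('c \<Rightarrow> 'c \<Rightarrow> 'c) \<Rightarrow> ('c \<Rightarrow> real)
      \<Rightarrow> ('k \<Rightarrow> 'x::ab_group_add \<Rightarrow> 'x) \<Rightarrow> 'x set \<Rightarrow> ('x \<Rightarrow> real) \<Rightarrow> ('c \<Rightarrow> 'x \<Rightarrow> 'x) \<Rightarrow> ('x \<Rightarrow> 'c \<Rightarrow> 'x)
      \<Rightarrow> ('c \<Rightarrow> 'x) \<Rightarrow> bool" where
  "derivation sC mul nC sX X nX l r D \<longleftrightarrow>
     Vector_Spaces.linear sC sX D \<and> range D \<subseteq> X \<and> (\<exists>M. \<forall>c. nX (D c) \<le> M * nC c)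
     \<and> (\<forall>c d. D (mul c d) = r (D c) d + l c (D d))"

definition ad :: "('c \<Rightarrow> 'x \<Rightarrow> 'x::minus) \<Rightarrow> ('x \<Rightarrow> 'c \<Rightarrow> 'x) \<Rightarrow> 'x \<Rightarrow> 'c \<Rightarrow> 'x" where
  "ad l r x = (\<lambda>c. l c x - r x c)"


subsection \<open>Existence of towers, and the product tower\<close>

text \<open>
  Starting from \<open>'v\<close>, each application of \<open>is_dual_tower_Suc\<close> adds one dual, at the price of a larger
  ambient type. \<open>is_dual_tower_prod\<close> justifies the identification of the duals of the amalgamated
  duplication with products of duals.
\<close>

lemma is_dual_tower_0:
  assumes "vector_space sV"
  shows "is_dual_tower sV nrm sV 0 \<lparr>emb = (\<lambda>v. v), lev = (\<lambda>_. UNIV), pair = p\<rparr>"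
proof -
  interpret vector_space sV by fact
  show ?thesis by (simp add: is_dual_tower_def linear_ident)
qed

lemma is_dual_tower_subspace:
  assumes "is_dual_tower sV nrm sX N T" "k \<le> N"
  shows "module.subspace sX (lev T k)"
proof (cases k)
  case 0
  from assms have "Vector_Spaces.linear sV sX (emb T)" by (simp add: is_dual_tower_def)
  then interpret Vector_Spaces.linear sV sX "emb T" .
  show ?thesis using assms 0 subspace_image[OF vs1.subspace_UNIV]
    by (simp add: is_dual_tower_def)
next
  case (Suc j)
  with assms show ?thesis by (simp add: is_dual_tower_def)
qed

lemma is_dual_tower_Suc:
  fixes T :: "('v::ab_group_add, 'x::ab_group_add, 'k::real_normed_field) tower"
  assumes tower: "is_dual_tower sV nrm sX N T"
  shows "\<exists>T' :: ('v, 'x \<times> ('x \<Rightarrow> 'k), 'k) tower.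
           is_dual_tower sV nrm (prod_scale sX (\<lambda>c \<phi> z. c * \<phi> z)) (Suc N) T'"
proof -
  define s' :: "'k \<Rightarrow> 'x \<times> ('x \<Rightarrow> 'k) \<Rightarrow> _" where "s' = prod_scale sX (\<lambda>c \<phi> z. c * \<phi> z)"
  define V where "V = lev T N"
  define F where "F = {\<phi>. bounded_functional sX V (level_norm nrm T N) \<phi> \<and> (\<forall>z. z \<notin> V \<longrightarrow> \<phi> z = 0)}"
  define T' :: "('v, 'x \<times> ('x \<Rightarrow> 'k), 'k) tower" where "T' = \<lparr>emb = (\<lambda>v. (emb T v, 0)),
     lev = (\<lambda>k. if k \<le> N then lev T k \<times> {0} else {0} \<times> F),
     pair = (\<lambda>k f x. if k < N then pair T k (fst f) (fst x) else snd f (fst x))\<rparr>"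
  have linT: "Vector_Spaces.linear sV sX (emb T)" and injT: "inj (emb T)" and lev0: "lev T 0 = range (emb T)"
    using tower by (simp_all add: is_dual_tower_def)
  interpret e: Vector_Spaces.linear sV sX "emb T" by fact
  interpret s': vector_space s'
    by unfold_locales (auto simp: s'_def prod_scale_def fun_eq_iff algebra_simps e.vs2.scale_right_distrib e.vs2.scale_left_distrib)
  have s'_simp: "s' c (a, \<phi>) = (sX c a, \<lambda>z. c * \<phi> z)" for c a \<phi>
    by (simp add: s'_def prod_scale_def)
  have sub: "e.vs2.subspace (lev T k)" if "k \<le> N" for k
    using is_dual_tower_subspace[OF tower that] .
  have V_add: "a + b \<in> V" if "a \<in> V" "b \<in> V" for a b
    using sub[of N] that by (auto simp: V_def e.vs2.subspace_def)
  have V_scale: "sX c a \<in> V" if "a \<in> V" for a c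
    using sub[of N] that by (auto simp: V_def e.vs2.subspace_def)
  have lin': "Vector_Spaces.linear sV s' (emb T')"
    by unfold_locales (auto simp: T'_def e.add e.scale s'_simp fun_eq_iff)
  have inj': "inj (emb T')" using injT by (auto simp: T'_def inj_def)
  have nrm': "level_norm nrm T' k (a, 0) = level_norm nrm T k a" if "k \<le> N" "a \<in> lev T k" for k a
    using that
  proof (induction k arbitrary: a)
    case 0
    then obtain v where v: "a = emb T v" using lev0 by auto
    have "(emb T v, 0) = emb T' v" by (simp add: T'_def)
    then show ?case using inj' injT by (simp only: v level_norm.simps inv_f_f)
  next
    case (Suc k)
    have "{z \<in> lev T' k. level_norm nrm T' k z \<le> 1} = (\<lambda>z. (z, 0)) ` {z \<in> lev T k. level_norm nrm T k z \<le> 1}"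
    proof -
      have "lev T' k = (\<lambda>z. (z, 0)) ` lev T k" using Suc.prems by (auto simp: T'_def)
      moreover have "level_norm nrm T' k (z, 0) = level_norm nrm T k z" if "z \<in> lev T k" for z
        using Suc.prems by (intro Suc.IH that) linarith
      ultimately show ?thesis by (simp add: Compr_image_eq cong: conj_cong)
    qed
    moreover have "pair T' k (a, 0) (z, 0) = pair T k a z" for z
      using Suc.prems by (simp add: T'_def)
    ultimately show ?case by (simp only: level_norm.simps image_image)
  qed
  have bf: "bounded_functional s' (lev T' k) (level_norm nrm T' k) \<phi> \<longleftrightarrow>
      bounded_functional sX (lev T k) (level_norm nrm T k) (\<lambda>a. \<phi> (a, 0))" if "k \<le> N" for k \<phi>
  proof -
    have "lev T' k = lev T k \<times> {0}" using that by (simp add: T'_def)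
    moreover have "(\<lambda>z. c * (0::'x \<Rightarrow> 'k) z) = 0" for c by (simp add: fun_eq_iff)
    ultimately show ?thesis using nrm'[OF that]
      by (simp add: bounded_functional_def s'_simp cong: ball_cong)
  qed
  have level: "module.subspace s' (lev T' (Suc k))
        \<and> (\<forall>f\<in>lev T' (Suc k). \<forall>g\<in>lev T' (Suc k). \<forall>x\<in>lev T' k.
              pair T' k (f + g) x = pair T' k f x + pair T' k g x)
        \<and> (\<forall>c. \<forall>f\<in>lev T' (Suc k). \<forall>x\<in>lev T' k. pair T' k (s' c f) x = c * pair T' k f x)
        \<and> (\<forall>f\<in>lev T' (Suc k). bounded_functional s' (lev T' k) (level_norm nrm T' k) (pair T' k f))
        \<and> (\<forall>\<phi>. bounded_functional s' (lev T' k) (level_norm nrm T' k) \<phi>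
              \<longrightarrow> (\<exists>!f. f \<in> lev T' (Suc k) \<and> (\<forall>x\<in>lev T' k. pair T' k f x = \<phi> x)))" if "k < Suc N" for k
  proof (cases "k < N")
    case True
    then have "\<forall>\<phi>. bounded_functional sX (lev T k) (level_norm nrm T k) \<phi>
              \<longrightarrow> (\<exists>!f. f \<in> lev T (Suc k) \<and> (\<forall>x\<in>lev T k. pair T k f x = \<phi> x))"
      using tower by (simp add: is_dual_tower_def)
    then have ex: "\<exists>!f. f \<in> lev T (Suc k) \<and> (\<forall>x\<in>lev T k. pair T k f x = \<phi> (x, 0))"
      if "bounded_functional sX (lev T k) (level_norm nrm T k) (\<lambda>a. \<phi> (a, 0))"
      for \<phi> :: "'x \<times> ('x \<Rightarrow> 'k) \<Rightarrow> 'k"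
      using that by blast
    have ex': "\<exists>!f. f \<in> lev T' (Suc k) \<and> (\<forall>x\<in>lev T' k. pair T' k f x = \<phi> x)"
      if b: "bounded_functional sX (lev T k) (level_norm nrm T k) (\<lambda>a. \<phi> (a, 0))" for \<phi>
    proof -
      from ex[OF b] obtain f where f: "f \<in> lev T (Suc k)" "\<forall>x\<in>lev T k. pair T k f x = \<phi> (x, 0)"
        and u: "\<And>g. g \<in> lev T (Suc k) \<Longrightarrow> \<forall>x\<in>lev T k. pair T k g x = \<phi> (x, 0) \<Longrightarrow> g = f" by blast
      show ?thesis
      proof (rule ex1I[of _ "(f, 0)"])
        show "(f, 0) \<in> lev T' (Suc k) \<and> (\<forall>x\<in>lev T' k. pair T' k (f, 0) x = \<phi> x)"
          using f True by (auto simp: T'_def)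
      next
        fix g assume "g \<in> lev T' (Suc k) \<and> (\<forall>x\<in>lev T' k. pair T' k g x = \<phi> x)"
        then show "g = (f, 0)" using True by (cases g) (auto simp: T'_def intro!: u)
      qed
    qed
    have "s'.subspace (lev T' (Suc k))"
      using sub[of "Suc k"] True by (auto simp: T'_def s'.subspace_def e.vs2.subspace_def s'_simp fun_eq_iff zero_prod_def)
    moreover have "\<forall>f\<in>lev T' (Suc k). \<forall>g\<in>lev T' (Suc k). \<forall>x\<in>lev T' k.
              pair T' k (f + g) x = pair T' k f x + pair T' k g x"
      using True tower by (auto simp: T'_def is_dual_tower_def)
    moreover have "\<forall>c. \<forall>f\<in>lev T' (Suc k). \<forall>x\<in>lev T' k. pair T' k (s' c f) x = c * pair T' k f x"
      using True tower by (auto simp: T'_def is_dual_tower_def s'_simp)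
    moreover have "\<forall>f\<in>lev T' (Suc k). bounded_functional s' (lev T' k) (level_norm nrm T' k) (pair T' k f)"
    proof -
      have "\<forall>f\<in>lev T (Suc k). bounded_functional sX (lev T k) (level_norm nrm T k) (pair T k f)"
        using True tower by (simp add: is_dual_tower_def)
      then show ?thesis using True bf[of k] by (auto simp: T'_def)
    qed
    ultimately show ?thesis using True ex' bf[of k] by simp
  next
    case False
    then have k: "k = N" using that by simp
    have levs: "lev T' N = V \<times> {0}" "lev T' (Suc N) = {0} \<times> F" by (simp_all add: T'_def V_def)
    have p: "pair T' N f x = snd f (fst x)" for f x by (simp add: T'_def)
    have "0 \<in> F" by (auto simp: F_def bounded_functional_def intro: exI[of _ 0])
    moreover have "\<phi> + \<psi> \<in> F" if h: "\<phi> \<in> F" "\<psi> \<in> F" for \<phi> \<psi>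
    proof -
      from h obtain M M' where "\<forall>z\<in>V. norm (\<phi> z) \<le> M * level_norm nrm T N z"
        "\<forall>z\<in>V. norm (\<psi> z) \<le> M' * level_norm nrm T N z"
        by (auto simp: F_def bounded_functional_def)
      then have "\<forall>z\<in>V. norm (\<phi> z + \<psi> z) \<le> (M + M') * level_norm nrm T N z"
        by (auto simp: distrib_right intro!: norm_triangle_le add_mono)
      then have "\<exists>M. \<forall>z\<in>V. norm (\<phi> z + \<psi> z) \<le> M * level_norm nrm T N z" by blast
      then show ?thesis using h by (simp add: F_def bounded_functional_def algebra_simps)
    qed
    moreover have "(\<lambda>z. c * \<phi> z) \<in> F" if h: "\<phi> \<in> F" for \<phi> c
    proof -
      from h obtain M where "\<forall>z\<in>V. norm (\<phi> z) \<le> M * level_norm nrm T N z"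
        by (auto simp: F_def bounded_functional_def)
      then have "\<forall>z\<in>V. norm (c * \<phi> z) \<le> (norm c * M) * level_norm nrm T N z"
        by (auto simp: norm_mult mult.assoc intro!: mult_left_mono)
      then have "\<exists>M. \<forall>z\<in>V. norm (c * \<phi> z) \<le> M * level_norm nrm T N z" by blast
      then show ?thesis using h by (simp add: F_def bounded_functional_def algebra_simps)
    qed
    ultimately have "s'.subspace (lev T' (Suc N))"
      by (auto simp: levs s'.subspace_def s'_simp zero_prod_def)
    moreover have "\<forall>f\<in>lev T' (Suc N). bounded_functional s' (lev T' N) (level_norm nrm T' N) (pair T' N f)"
      using bf[of N] by (auto simp: levs p F_def V_def)
    moreover have "\<exists>!f. f \<in> lev T' (Suc N) \<and> (\<forall>x\<in>lev T' N. pair T' N f x = \<phi> x)"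
      if b: "bounded_functional s' (lev T' N) (level_norm nrm T' N) \<phi>" for \<phi>
    proof (rule ex1I[of _ "(0, \<lambda>z. if z \<in> V then \<phi> (z, 0) else 0)"])
      have "bounded_functional sX V (level_norm nrm T N) (\<lambda>z. \<phi> (z, 0))"
        using b bf[of N] by (simp add: V_def)
      then show "(0, \<lambda>z. if z \<in> V then \<phi> (z, 0) else 0) \<in> lev T' (Suc N) \<and>
          (\<forall>x\<in>lev T' N. pair T' N (0, \<lambda>z. if z \<in> V then \<phi> (z, 0) else 0) x = \<phi> x)"
        by (auto simp: levs p F_def bounded_functional_def V_add V_scale)
    next
      fix f assume "f \<in> lev T' (Suc N) \<and> (\<forall>x\<in>lev T' N. pair T' N f x = \<phi> x)"
      then show "f = (0, \<lambda>z. if z \<in> V then \<phi> (z, 0) else 0)"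
        by (cases f) (auto simp: levs p F_def fun_eq_iff)
    qed
    ultimately show ?thesis by (auto simp: k p s'_simp levs)
  qed
  have "lev T' 0 = range (emb T')" using lev0 by (auto simp: T'_def)
  with lin' inj' level have "is_dual_tower sV nrm s' (Suc N) T'"
    unfolding is_dual_tower_def by blast
  then show ?thesis unfolding s'_def by blast
qed

lemma is_dual_tower_prod:
  fixes S :: "('a::real_normed_vector, 'x::ab_group_add, 'k::real_normed_field) tower"
    and T :: "('b::real_normed_vector, 'y::ab_group_add, 'k) tower"
  assumes S: "is_dual_tower sA norm sX N S" and T: "is_dual_tower sB norm sY N T"
  shows "is_dual_tower (prod_scale sA sB) amalg_norm (prod_scale sX sY) N (prod_tower S T)"
proof -
  let ?s = "prod_scale sX sY" and ?P = "prod_tower S T"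
  have lins: "Vector_Spaces.linear sA sX (emb S)" "Vector_Spaces.linear sB sY (emb T)"
    and injs: "inj (emb S)" "inj (emb T)"
    and lev0: "lev S 0 = range (emb S)" "lev T 0 = range (emb T)"
    using S T by (simp_all add: is_dual_tower_def)
  interpret e: Vector_Spaces.linear sA sX "emb S" by fact
  interpret d: Vector_Spaces.linear sB sY "emb T" by fact
  interpret P1: vector_space "prod_scale sA sB"
    by unfold_locales (auto simp: prod_scale_def e.vs1.scale_right_distrib e.vs1.scale_left_distrib
        d.vs1.scale_right_distrib d.vs1.scale_left_distrib)
  interpret P2: vector_space ?s
    by unfold_locales (auto simp: prod_scale_def e.vs2.scale_right_distrib e.vs2.scale_left_distrib
        d.vs2.scale_right_distrib d.vs2.scale_left_distrib)
  have linP: "Vector_Spaces.linear (prod_scale sA sB) ?s (emb ?P)"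
    by unfold_locales (auto simp: prod_tower_def prod_scale_def e.add d.add e.scale d.scale)
  have injP: "inj (emb ?P)" using injs by (auto simp: prod_tower_def inj_def)
  have levP: "lev ?P k = lev S k \<times> lev T k" for k by (simp add: prod_tower_def)
  have pairP: "pair ?P k f x = pair S k (fst f) (fst x) + pair T k (snd f) (snd x)" for k f x
    by (simp add: prod_tower_def)
  have subS: "e.vs2.subspace (lev S k)" and subT: "d.vs2.subspace (lev T k)" if "k \<le> N" for k
    using is_dual_tower_subspace[OF S that] is_dual_tower_subspace[OF T that] .
  have zero: "0 \<in> lev S k" "0 \<in> lev T k" if "k \<le> N" for k
    using subS[OF that] subT[OF that] by (auto simp: e.vs2.subspace_def d.vs2.subspace_def)

  let ?n = "level_norm norm S" and ?m = "level_norm norm T" and ?q = "level_norm amalg_norm ?P"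
  have bfS: "bounded_functional sX (lev S k) (?n k) (pair S k f)" if "k < N" "f \<in> lev S (Suc k)" for k f
    using S that by (simp add: is_dual_tower_def)
  have bfT: "bounded_functional sY (lev T k) (?m k) (pair T k f)" if "k < N" "f \<in> lev T (Suc k)" for k f
    using T that by (simp add: is_dual_tower_def)
  have pz: "pair S k f 0 = 0" if "k < N" "f \<in> lev S (Suc k)" for k f
    using bfS[OF that] zero(1)[of k] that unfolding bounded_functional_def
    by (metis add_cancel_right_right less_imp_le)
  have pz': "pair T k f 0 = 0" if "k < N" "f \<in> lev T (Suc k)" for k f
    using bfT[OF that] zero(2)[of k] that unfolding bounded_functional_def
    by (metis add_cancel_right_right less_imp_le)
  have zp: "pair S k 0 u = 0" if "k < N" "u \<in> lev S k" for k u
  proof -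
    have "\<forall>c. \<forall>f\<in>lev S (Suc k). \<forall>x\<in>lev S k. pair S k (sX c f) x = c * pair S k f x"
      using S that by (simp add: is_dual_tower_def)
    from this[rule_format, of 0 u 0] zero(1)[of "Suc k"] that show ?thesis by simp
  qed
  have zp': "pair T k 0 u = 0" if "k < N" "u \<in> lev T k" for k u
  proof -
    have "\<forall>c. \<forall>f\<in>lev T (Suc k). \<forall>x\<in>lev T k. pair T k (sY c f) x = c * pair T k f x"
      using T that by (simp add: is_dual_tower_def)
    from this[rule_format, of 0 u 0] zero(2)[of "Suc k"] that show ?thesis by simp
  qed

  have basic: "k \<le> N \<Longrightarrow> ?n k 0 = 0 \<and> ?m k 0 = 0 \<and> (\<forall>u\<in>lev S k. 0 \<le> ?n k u) \<and> (\<forall>w\<in>lev T k. 0 \<le> ?m k w)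
     \<and> (\<forall>u\<in>lev S k. \<forall>w\<in>lev T k. ?n k u \<le> ?q k (u, w) \<and> ?m k w \<le> ?q k (u, w) \<and> ?q k (u, w) \<le> ?n k u + ?m k w)" for k
  proof (induction k)
    case 0
    have iS: "inv (emb S) 0 = 0" and iT: "inv (emb T) 0 = 0"
      using injs e.zero d.zero by (metis inv_f_f)+
    have iP: "inv (emb ?P) (emb S a, emb T b) = (a, b)" for a b
    proof -
      have "(emb S a, emb T b) = emb ?P (a, b)" by (simp add: prod_tower_def)
      then show ?thesis using injP by (metis inv_f_f)
    qed
    show ?case using injs by (auto simp: iS iT lev0 iP amalg_norm_def)
  next
    case (Suc k)
    then have k: "k < N" and IH: "?n k 0 = 0" "?m k 0 = 0" "\<And>u. u \<in> lev S k \<Longrightarrow> 0 \<le> ?n k u"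
      "\<And>w. w \<in> lev T k \<Longrightarrow> 0 \<le> ?m k w"
      "\<And>u w. u \<in> lev S k \<Longrightarrow> w \<in> lev T k \<Longrightarrow> ?n k u \<le> ?q k (u, w)"
      "\<And>u w. u \<in> lev S k \<Longrightarrow> w \<in> lev T k \<Longrightarrow> ?m k w \<le> ?q k (u, w)"
      "\<And>u w. u \<in> lev S k \<Longrightarrow> w \<in> lev T k \<Longrightarrow> ?q k (u, w) \<le> ?n k u + ?m k w" by auto
    define US where "US = {u \<in> lev S k. ?n k u \<le> 1}"
    define UT where "UT = {w \<in> lev T k. ?m k w \<le> 1}"
    define UP where "UP = {z \<in> lev ?P k. ?q k z \<le> 1}"
    have z: "0 \<in> US" "0 \<in> UT" using zero[of k] k IH by (simp_all add: US_def UT_def)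
    have inP: "u \<in> US \<and> w \<in> UT" if "(u, w) \<in> UP" for u w
    proof -
      from that have h: "u \<in> lev S k" "w \<in> lev T k" "?q k (u, w) \<le> 1" by (auto simp: UP_def levP)
      then show ?thesis using IH(5)[of u w] IH(6)[of u w] by (auto simp: US_def UT_def)
    qed
    have inP1: "(u, 0) \<in> UP" if "u \<in> US" for u
      using that IH(7)[of u 0] IH(2) zero[of k] k by (auto simp: US_def UP_def levP)
    have inP2: "(0, w) \<in> UP" if "w \<in> UT" for w
      using that IH(7)[of 0 w] IH(1) zero[of k] k by (auto simp: UT_def UP_def levP)
    have bS: "\<exists>B. \<forall>u\<in>US. norm (pair S k f u) \<le> B" if f: "f \<in> lev S (Suc k)" for f
    proof -
      from bfS[OF k f] obtain M where M: "\<forall>u\<in>lev S k. norm (pair S k f u) \<le> M * ?n k u"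
        by (auto simp: bounded_functional_def)
      have "norm (pair S k f u) \<le> \<bar>M\<bar>" if "u \<in> US" for u
      proof -
        have "norm (pair S k f u) \<le> M * ?n k u" using M that by (auto simp: US_def)
        also have "\<dots> \<le> \<bar>M\<bar> * ?n k u" using IH(3)[of u] that by (auto simp: US_def intro: mult_right_mono)
        also have "\<dots> \<le> \<bar>M\<bar>" using that by (auto simp: US_def intro: mult_left_le)
        finally show ?thesis .
      qed
      then show ?thesis by blast
    qed
    have bT: "\<exists>B. \<forall>u\<in>UT. norm (pair T k f u) \<le> B" if f: "f \<in> lev T (Suc k)" for f
    proof -
      from bfT[OF k f] obtain M where M: "\<forall>u\<in>lev T k. norm (pair T k f u) \<le> M * ?m k u"
        by (auto simp: bounded_functional_def)
      have "norm (pair T k f u) \<le> \<bar>M\<bar>" if "u \<in> UT" for u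
      proof -
        have "norm (pair T k f u) \<le> M * ?m k u" using M that by (auto simp: UT_def)
        also have "\<dots> \<le> \<bar>M\<bar> * ?m k u" using IH(4)[of u] that by (auto simp: UT_def intro: mult_right_mono)
        also have "\<dots> \<le> \<bar>M\<bar>" using that by (auto simp: UT_def intro: mult_left_le)
        finally show ?thesis .
      qed
      then show ?thesis by blast
    qed
    have nS: "?n (Suc k) f = (SUP u\<in>US. norm (pair S k f u))" for f by (simp add: US_def)
    have nT: "?m (Suc k) f = (SUP u\<in>UT. norm (pair T k f u))" for f by (simp add: UT_def)
    have nP: "?q (Suc k) f = (SUP u\<in>UP. norm (pair ?P k f u))" for f by (simp add: UP_def)
    have bddS: "bdd_above ((\<lambda>u. norm (pair S k f u)) ` US)" if "f \<in> lev S (Suc k)" for f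
      using bS[OF that] by (auto simp: bdd_above_def)
    have bddT: "bdd_above ((\<lambda>u. norm (pair T k f u)) ` UT)" if "f \<in> lev T (Suc k)" for f
      using bT[OF that] by (auto simp: bdd_above_def)
    have upS: "norm (pair S k f u) \<le> ?n (Suc k) f" if "f \<in> lev S (Suc k)" "u \<in> US" for f u
      unfolding nS using bddS[OF that(1)] that(2) by (rule cSUP_upper2) simp
    have upT: "norm (pair T k f u) \<le> ?m (Suc k) f" if "f \<in> lev T (Suc k)" "u \<in> UT" for f u
      unfolding nT using bddT[OF that(1)] that(2) by (rule cSUP_upper2) simp
    have le: "norm (pair ?P k (f, g) z) \<le> ?n (Suc k) f + ?m (Suc k) g"
      if "f \<in> lev S (Suc k)" "g \<in> lev T (Suc k)" "z \<in> UP" for f g z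
      using that inP[of "fst z" "snd z"]
      by (auto simp: pairP simp del: level_norm.simps intro!: norm_triangle_le add_mono upS upT)
    have bddP: "bdd_above ((\<lambda>u. norm (pair ?P k (f, g) u)) ` UP)" if "f \<in> lev S (Suc k)" "g \<in> lev T (Suc k)" for f g
      by (rule bdd_aboveI2[where M = "?n (Suc k) f + ?m (Suc k) g"]) (rule le[OF that])
    have upP: "norm (pair ?P k (f, g) z) \<le> ?q (Suc k) (f, g)"
      if "f \<in> lev S (Suc k)" "g \<in> lev T (Suc k)" "z \<in> UP" for f g z
      unfolding nP using bddP[OF that(1,2)] that(3) by (rule cSUP_upper2) simp
    have "?n (Suc k) 0 = 0"
    proof -
      have "?n (Suc k) 0 = (SUP u\<in>US. 0::real)" unfolding nS
        by (rule SUP_cong) (auto simp: US_def zp k)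
      then show ?thesis using z by (metis cSUP_const empty_iff)
    qed
    moreover have "?m (Suc k) 0 = 0"
    proof -
      have "?m (Suc k) 0 = (SUP u\<in>UT. 0::real)" unfolding nT
        by (rule SUP_cong) (auto simp: UT_def zp' k)
      then show ?thesis using z by (metis cSUP_const empty_iff)
    qed
    moreover have "0 \<le> ?n (Suc k) f" if "f \<in> lev S (Suc k)" for f
      using upS[OF that z(1)] norm_ge_zero order_trans by blast
    moreover have "0 \<le> ?m (Suc k) f" if "f \<in> lev T (Suc k)" for f
      using upT[OF that z(2)] norm_ge_zero order_trans by blast
    moreover have "?n (Suc k) f \<le> ?q (Suc k) (f, g)" if "f \<in> lev S (Suc k)" "g \<in> lev T (Suc k)" for f g
    proof -
      have "norm (pair S k f u) \<le> ?q (Suc k) (f, g)" if "u \<in> US" for u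
        using upP[OF \<open>f \<in> _\<close> \<open>g \<in> _\<close> inP1[OF that]] pz'[OF k \<open>g \<in> _\<close>] by (simp add: pairP del: level_norm.simps)
      then show ?thesis unfolding nS using z by (intro cSUP_least) auto
    qed
    moreover have "?m (Suc k) g \<le> ?q (Suc k) (f, g)" if "f \<in> lev S (Suc k)" "g \<in> lev T (Suc k)" for f g
    proof -
      have "norm (pair T k g u) \<le> ?q (Suc k) (f, g)" if "u \<in> UT" for u
        using upP[OF \<open>f \<in> _\<close> \<open>g \<in> _\<close> inP2[OF that]] pz[OF k \<open>f \<in> _\<close>] by (simp add: pairP del: level_norm.simps)
      then show ?thesis unfolding nT using z by (intro cSUP_least) auto
    qed
    moreover have "?q (Suc k) (f, g) \<le> ?n (Suc k) f + ?m (Suc k) g" if "f \<in> lev S (Suc k)" "g \<in> lev T (Suc k)" for f g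
      unfolding nP using inP1[OF z(1)] le[OF that] by (intro cSUP_least) auto
    ultimately show ?case by (simp del: level_norm.simps)
  qed

  have bf_iff: "bounded_functional ?s (lev ?P k) (?q k) \<phi> \<longleftrightarrow>
       (\<exists>\<phi>1 \<phi>2. bounded_functional sX (lev S k) (?n k) \<phi>1 \<and> bounded_functional sY (lev T k) (?m k) \<phi>2
          \<and> (\<forall>u\<in>lev S k. \<forall>w\<in>lev T k. \<phi> (u, w) = \<phi>1 u + \<phi>2 w))" (is "?L \<longleftrightarrow> ?R") if k: "k \<le> N" for k \<phi>
  proof
    assume L: ?L
    then obtain M where M: "\<forall>z\<in>lev ?P k. norm (\<phi> z) \<le> M * ?q k z"
      and add: "\<forall>x\<in>lev ?P k. \<forall>y\<in>lev ?P k. \<phi> (x + y) = \<phi> x + \<phi> y"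
      and scale: "\<forall>c. \<forall>x\<in>lev ?P k. \<phi> (?s c x) = c * \<phi> x"
      by (auto simp: bounded_functional_def)
    have q: "norm (\<phi> (u, w)) \<le> \<bar>M\<bar> * (?n k u + ?m k w)" if "u \<in> lev S k" "w \<in> lev T k" for u w
    proof -
      have q0: "0 \<le> ?q k (u, w)" using basic[OF k] that by (meson order_trans)
      have "norm (\<phi> (u, w)) \<le> M * ?q k (u, w)" using M that by (auto simp: levP)
      also have "\<dots> \<le> \<bar>M\<bar> * ?q k (u, w)" using q0 by (auto intro: mult_right_mono)
      also have "\<dots> \<le> \<bar>M\<bar> * (?n k u + ?m k w)" using basic[OF k] that by (auto intro: mult_left_mono)
      finally show ?thesis .
    qed
    show ?R
    proof (intro exI conjI)
      show "bounded_functional sX (lev S k) (?n k) (\<lambda>u. \<phi> (u, 0))"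
        unfolding bounded_functional_def
      proof (intro conjI)
        show "\<forall>x\<in>lev S k. \<forall>y\<in>lev S k. \<phi> (x + y, 0) = \<phi> (x, 0) + \<phi> (y, 0)"
        proof (intro ballI)
          fix x y assume "x \<in> lev S k" "y \<in> lev S k"
          then show "\<phi> (x + y, 0) = \<phi> (x, 0) + \<phi> (y, 0)"
            using add[rule_format, of "(x, 0)" "(y, 0)"] zero[OF k] by (simp add: levP)
        qed
        show "\<forall>c. \<forall>x\<in>lev S k. \<phi> (sX c x, 0) = c * \<phi> (x, 0)"
        proof (intro allI ballI)
          fix c x assume "x \<in> lev S k"
          then show "\<phi> (sX c x, 0) = c * \<phi> (x, 0)"
            using scale[rule_format, of "(x, 0)" c] zero[OF k] by (simp add: levP prod_scale_def)
        qed
        show "\<exists>M. \<forall>x\<in>lev S k. norm (\<phi> (x, 0)) \<le> M * ?n k x"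
          using q[of _ 0] zero[OF k] basic[OF k] by (intro exI[of _ "\<bar>M\<bar>"]) auto
      qed
      show "bounded_functional sY (lev T k) (?m k) (\<lambda>w. \<phi> (0, w))"
        unfolding bounded_functional_def
      proof (intro conjI)
        show "\<forall>x\<in>lev T k. \<forall>y\<in>lev T k. \<phi> (0, x + y) = \<phi> (0, x) + \<phi> (0, y)"
        proof (intro ballI)
          fix x y assume "x \<in> lev T k" "y \<in> lev T k"
          then show "\<phi> (0, x + y) = \<phi> (0, x) + \<phi> (0, y)"
            using add[rule_format, of "(0, x)" "(0, y)"] zero[OF k] by (simp add: levP)
        qed
        show "\<forall>c. \<forall>x\<in>lev T k. \<phi> (0, sY c x) = c * \<phi> (0, x)"
        proof (intro allI ballI)
          fix c x assume "x \<in> lev T k"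
          then show "\<phi> (0, sY c x) = c * \<phi> (0, x)"
            using scale[rule_format, of "(0, x)" c] zero[OF k] by (simp add: levP prod_scale_def)
        qed
        show "\<exists>M. \<forall>x\<in>lev T k. norm (\<phi> (0, x)) \<le> M * ?m k x"
          using q[of 0] zero[OF k] basic[OF k] by (intro exI[of _ "\<bar>M\<bar>"]) auto
      qed
      show "\<forall>u\<in>lev S k. \<forall>w\<in>lev T k. \<phi> (u, w) = \<phi> (u, 0) + \<phi> (0, w)"
      proof (intro ballI)
        fix u w assume "u \<in> lev S k" "w \<in> lev T k"
        then show "\<phi> (u, w) = \<phi> (u, 0) + \<phi> (0, w)"
          using add[rule_format, of "(u, 0)" "(0, w)"] zero[OF k] by (simp add: levP)
      qed
    qed
  next
    assume ?R
    then obtain \<phi>1 \<phi>2 where b1: "bounded_functional sX (lev S k) (?n k) \<phi>1"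
      and b2: "bounded_functional sY (lev T k) (?m k) \<phi>2"
      and eq: "\<And>u w. u \<in> lev S k \<Longrightarrow> w \<in> lev T k \<Longrightarrow> \<phi> (u, w) = \<phi>1 u + \<phi>2 w" by blast
    obtain M1 M2 where M: "\<forall>u\<in>lev S k. norm (\<phi>1 u) \<le> M1 * ?n k u" "\<forall>w\<in>lev T k. norm (\<phi>2 w) \<le> M2 * ?m k w"
      using b1 b2 by (auto simp: bounded_functional_def)
    have bnd: "norm (\<phi> (u, w)) \<le> (\<bar>M1\<bar> + \<bar>M2\<bar>) * ?q k (u, w)" if "u \<in> lev S k" "w \<in> lev T k" for u w
    proof -
      have "norm (\<phi>1 u) \<le> \<bar>M1\<bar> * ?q k (u, w)"
      proof -
        have "norm (\<phi>1 u) \<le> M1 * ?n k u" using M that by auto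
        also have "\<dots> \<le> \<bar>M1\<bar> * ?n k u" using basic[OF k] that by (auto intro: mult_right_mono)
        also have "\<dots> \<le> \<bar>M1\<bar> * ?q k (u, w)" using basic[OF k] that by (auto intro: mult_left_mono)
        finally show ?thesis .
      qed
      moreover have "norm (\<phi>2 w) \<le> \<bar>M2\<bar> * ?q k (u, w)"
      proof -
        have "norm (\<phi>2 w) \<le> M2 * ?m k w" using M that by auto
        also have "\<dots> \<le> \<bar>M2\<bar> * ?m k w" using basic[OF k] that by (auto intro: mult_right_mono)
        also have "\<dots> \<le> \<bar>M2\<bar> * ?q k (u, w)" using basic[OF k] that by (auto intro: mult_left_mono)
        finally show ?thesis .
      qed
      ultimately show ?thesis using eq[OF that] by (auto simp: distrib_right intro!: norm_triangle_le)
    qed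
    have cl: "u + u' \<in> lev S k" "sX c u \<in> lev S k" if "u \<in> lev S k" "u' \<in> lev S k" for u u' c
      using that subS[OF k] by (auto simp: e.vs2.subspace_def)
    have cl': "u + u' \<in> lev T k" "sY c u \<in> lev T k" if "u \<in> lev T k" "u' \<in> lev T k" for u u' c
      using that subT[OF k] by (auto simp: d.vs2.subspace_def)
    show ?L unfolding bounded_functional_def
    proof (intro conjI)
      show "\<forall>x\<in>lev ?P k. \<forall>y\<in>lev ?P k. \<phi> (x + y) = \<phi> x + \<phi> y"
        using b1 b2 cl cl' by (auto simp: levP eq bounded_functional_def)
      show "\<forall>c. \<forall>x\<in>lev ?P k. \<phi> (?s c x) = c * \<phi> x"
        using b1 b2 cl cl' by (auto simp: levP eq bounded_functional_def prod_scale_def algebra_simps)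
      show "\<exists>M. \<forall>x\<in>lev ?P k. norm (\<phi> x) \<le> M * ?q k x"
        using bnd by (auto simp: levP)
    qed
  qed

  have level: "P2.subspace (lev ?P (Suc k))
        \<and> (\<forall>f\<in>lev ?P (Suc k). \<forall>g\<in>lev ?P (Suc k). \<forall>x\<in>lev ?P k.
              pair ?P k (f + g) x = pair ?P k f x + pair ?P k g x)
        \<and> (\<forall>c. \<forall>f\<in>lev ?P (Suc k). \<forall>x\<in>lev ?P k. pair ?P k (?s c f) x = c * pair ?P k f x)
        \<and> (\<forall>f\<in>lev ?P (Suc k). bounded_functional ?s (lev ?P k) (?q k) (pair ?P k f))
        \<and> (\<forall>\<phi>. bounded_functional ?s (lev ?P k) (?q k) \<phi>
              \<longrightarrow> (\<exists>!f. f \<in> lev ?P (Suc k) \<and> (\<forall>x\<in>lev ?P k. pair ?P k f x = \<phi> x)))" if k: "k < N" for k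
  proof (intro conjI)
    show "P2.subspace (lev ?P (Suc k))"
      using subS[of "Suc k"] subT[of "Suc k"] k
      by (auto simp: levP P2.subspace_def e.vs2.subspace_def d.vs2.subspace_def prod_scale_def zero_prod_def)
    show "\<forall>f\<in>lev ?P (Suc k). \<forall>g\<in>lev ?P (Suc k). \<forall>x\<in>lev ?P k.
              pair ?P k (f + g) x = pair ?P k f x + pair ?P k g x"
      using S T k by (auto simp: levP pairP is_dual_tower_def)
    show "\<forall>c. \<forall>f\<in>lev ?P (Suc k). \<forall>x\<in>lev ?P k. pair ?P k (?s c f) x = c * pair ?P k f x"
      using S T k by (auto simp: levP pairP is_dual_tower_def prod_scale_def algebra_simps)
    show "\<forall>f\<in>lev ?P (Suc k). bounded_functional ?s (lev ?P k) (?q k) (pair ?P k f)"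
    proof
      fix f assume "f \<in> lev ?P (Suc k)"
      then have f: "fst f \<in> lev S (Suc k)" "snd f \<in> lev T (Suc k)" by (auto simp: levP)
      show "bounded_functional ?s (lev ?P k) (?q k) (pair ?P k f)"
        unfolding bf_iff[OF less_imp_le[OF k]]
        using bfS[OF k f(1)] bfT[OF k f(2)] by (auto simp: pairP)
    qed
    show "\<forall>\<phi>. bounded_functional ?s (lev ?P k) (?q k) \<phi>
              \<longrightarrow> (\<exists>!f. f \<in> lev ?P (Suc k) \<and> (\<forall>x\<in>lev ?P k. pair ?P k f x = \<phi> x))"
    proof (intro allI impI)
      fix \<phi> assume "bounded_functional ?s (lev ?P k) (?q k) \<phi>"
      then obtain \<phi>1 \<phi>2 where b: "bounded_functional sX (lev S k) (?n k) \<phi>1"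
        "bounded_functional sY (lev T k) (?m k) \<phi>2"
        and eq: "\<And>u w. u \<in> lev S k \<Longrightarrow> w \<in> lev T k \<Longrightarrow> \<phi> (u, w) = \<phi>1 u + \<phi>2 w"
        unfolding bf_iff[OF less_imp_le[OF k]] by blast
      have z1: "\<phi>1 0 = 0" using b(1) zero(1)[of k] k unfolding bounded_functional_def
        by (metis add_cancel_right_right less_imp_le)
      have z2: "\<phi>2 0 = 0" using b(2) zero(2)[of k] k unfolding bounded_functional_def
        by (metis add_cancel_right_right less_imp_le)
      have "\<exists>!f. f \<in> lev S (Suc k) \<and> (\<forall>x\<in>lev S k. pair S k f x = \<phi>1 x)"
        "\<exists>!f. f \<in> lev T (Suc k) \<and> (\<forall>x\<in>lev T k. pair T k f x = \<phi>2 x)"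
        using S T k b by (auto simp: is_dual_tower_def)
      then obtain f g where f: "f \<in> lev S (Suc k)" "\<forall>x\<in>lev S k. pair S k f x = \<phi>1 x"
        and g: "g \<in> lev T (Suc k)" "\<forall>x\<in>lev T k. pair T k g x = \<phi>2 x"
        and uf: "\<And>h. h \<in> lev S (Suc k) \<Longrightarrow> \<forall>x\<in>lev S k. pair S k h x = \<phi>1 x \<Longrightarrow> h = f"
        and ug: "\<And>h. h \<in> lev T (Suc k) \<Longrightarrow> \<forall>x\<in>lev T k. pair T k h x = \<phi>2 x \<Longrightarrow> h = g" by blast
      show "\<exists>!f. f \<in> lev ?P (Suc k) \<and> (\<forall>x\<in>lev ?P k. pair ?P k f x = \<phi> x)"
      proof (rule ex1I[of _ "(f, g)"])
        show "(f, g) \<in> lev ?P (Suc k) \<and> (\<forall>x\<in>lev ?P k. pair ?P k (f, g) x = \<phi> x)"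
          using f g by (auto simp: levP pairP eq)
      next
        fix h assume h: "h \<in> lev ?P (Suc k) \<and> (\<forall>x\<in>lev ?P k. pair ?P k h x = \<phi> x)"
        then have hh: "fst h \<in> lev S (Suc k)" "snd h \<in> lev T (Suc k)" by (auto simp: levP)
        have "pair S k (fst h) u = \<phi>1 u" if "u \<in> lev S k" for u
          using h[THEN conjunct2, rule_format, of "(u, 0)"] that zero(2)[of k] k pz'[OF k hh(2)] eq[of u 0] z2
          by (simp add: levP pairP)
        moreover have "pair T k (snd h) u = \<phi>2 u" if "u \<in> lev T k" for u
          using h[THEN conjunct2, rule_format, of "(0, u)"] that zero(1)[of k] k pz[OF k hh(1)] eq[of 0 u] z1
          by (simp add: levP pairP)
        ultimately show "h = (f, g)" using uf[OF hh(1)] ug[OF hh(2)] by (auto simp: prod_eq_iff)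
      qed
    qed
  qed
  have "lev ?P 0 = range (emb ?P)"
    using lev0 by (auto simp: levP prod_tower_def)
  with linP injP level show ?thesis unfolding is_dual_tower_def by blast
qed

end

theory Submission
  imports Defs
begin

text \<open>
  The bimodule structure of the duals of \<open>A \<rtimes> B\<close> can be computed in coordinates. On level \<open>0\<close> the
  product gives
  \<open>(a, \<beta>) \<cdot> (u, w) = (a \<cdot> u + \<beta> \<cdot> u + a \<triangle> w, \<beta> \<cdot> w)\<close>, and its mirror image on the right. Since the
  pairing is coordinatewise, dualising transposes this triangular matrix of operators:
  on odd levels \<open>(a, \<beta>) \<cdot> (f, g) = (a \<cdot> f + \<beta> \<cdot> f, a \<triangle> f + \<beta> \<cdot> g)\<close>, and dualising once more restores
  the first shape. The mixed operations are defined by exactly the recursion that the off-diagonal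
  entries obey, so both shapes persist by induction (\<open>prod_tower_even_actions\<close>,
  \<open>prod_tower_odd_actions\<close>).

  On an odd level, therefore, \<open>ad (x, y) (a, \<beta>)\<close> has the coordinates \<open>ad x a + ad x \<beta>\<close> and
  \<open>(a \<triangle> x - x \<bullet> a) + ad y \<beta>\<close>. All four summands vanish at \<open>0\<close>, so comparing with \<open>D\<close> at
  \<open>(a, 0)\<close> and at \<open>(0, \<beta>)\<close> separates them, which is the claimed equivalence.

  The analytic content is that each operation is well defined: an element of a dual is described
  as the functional with prescribed values, which exists only if these values depend boundedly on
  the argument. This is the fact that the adjoint of a bounded map is bounded (\<open>level_map_adjoint\<close>).
\<close>

section \<open>Elements of a dual and their values\<close>

lemma level_eqI:
  assumes "is_dual_tower sV nrm sX N T" "k < N" "f \<in> lev T (Suc k)" "g \<in> lev T (Suc k)"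
    and "\<And>x. x \<in> lev T k \<Longrightarrow> pair T k f x = pair T k g x"
  shows "f = g"
proof -
  have "bounded_functional sX (lev T k) (level_norm nrm T k) (pair T k g)"
    using assms by (simp add: is_dual_tower_def)
  then have "\<exists>!h. h \<in> lev T (Suc k) \<and> (\<forall>x\<in>lev T k. pair T k h x = pair T k g x)"
    using assms by (simp add: is_dual_tower_def)
  then show ?thesis using assms by blast
qed

lemma functional_eqI:
  assumes "is_dual_tower sV nrm sX N T" "k < N" "f \<in> lev T (Suc k)"
    and "\<And>x. x \<in> lev T k \<Longrightarrow> pair T k f x = \<phi> x"
  shows "functional T k \<phi> = f"
  unfolding functional_def
proof (rule the_equality)
  show "f \<in> lev T (Suc k) \<and> (\<forall>x\<in>lev T k. pair T k f x = \<phi> x)" using assms by blast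
next
  fix g assume "g \<in> lev T (Suc k) \<and> (\<forall>x\<in>lev T k. pair T k g x = \<phi> x)"
  then show "g = f" using level_eqI[OF assms(1,2), of g f] assms(3,4) by simp
qed

lemma functional_in_level:
  assumes "is_dual_tower sV nrm sX N T" "k < N"
    and "bounded_functional sX (lev T k) (level_norm nrm T k) \<phi>"
  shows "functional T k \<phi> \<in> lev T (Suc k)"
    and "x \<in> lev T k \<Longrightarrow> pair T k (functional T k \<phi>) x = \<phi> x"
proof -
  have "\<exists>!f. f \<in> lev T (Suc k) \<and> (\<forall>x\<in>lev T k. pair T k f x = \<phi> x)"
    using assms by (simp add: is_dual_tower_def)
  from theI'[OF this]
  show "functional T k \<phi> \<in> lev T (Suc k)"
    and "x \<in> lev T k \<Longrightarrow> pair T k (functional T k \<phi>) x = \<phi> x"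
    by (simp_all add: functional_def)
qed

locale normed_dual_tower =
  fixes sV :: "'k::real_normed_field \<Rightarrow> 'v::ab_group_add \<Rightarrow> 'v" and nrm :: "'v \<Rightarrow> real"
    and sX :: "'k \<Rightarrow> 'x::ab_group_add \<Rightarrow> 'x" and N :: nat and T :: "('v, 'x, 'k) tower"
  assumes tower: "is_dual_tower sV nrm sX N T"
    and nrm_nonneg: "0 \<le> nrm v"
    and nrm_scale: "nrm (sV c v) \<le> norm c * nrm v"
begin

sublocale emb: Vector_Spaces.linear sV sX "emb T"
  using tower by (simp add: is_dual_tower_def)

lemma inv_emb [simp]: "inv (emb T) (emb T v) = v"
  using tower by (simp add: is_dual_tower_def)

lemma level_0: "lev T 0 = range (emb T)"
  using tower by (simp add: is_dual_tower_def)

lemma level_subspace: "k \<le> N \<Longrightarrow> emb.vs2.subspace (lev T k)"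
  using is_dual_tower_subspace[OF tower] .

lemma level_zero: "k \<le> N \<Longrightarrow> 0 \<in> lev T k"
  using level_subspace by (simp add: emb.vs2.subspace_def)

lemma level_add: "k \<le> N \<Longrightarrow> x \<in> lev T k \<Longrightarrow> y \<in> lev T k \<Longrightarrow> x + y \<in> lev T k"
  using level_subspace by (simp add: emb.vs2.subspace_def)

lemma level_scale: "k \<le> N \<Longrightarrow> x \<in> lev T k \<Longrightarrow> sX c x \<in> lev T k"
  using level_subspace by (simp add: emb.vs2.subspace_def)

lemma pair_bounded_functional:
  "k < N \<Longrightarrow> f \<in> lev T (Suc k) \<Longrightarrow>
    bounded_functional sX (lev T k) (level_norm nrm T k) (pair T k f)"
  using tower by (simp add: is_dual_tower_def)

lemma pair_add_left:
  "k < N \<Longrightarrow> f \<in> lev T (Suc k) \<Longrightarrow> g \<in> lev T (Suc k) \<Longrightarrow> x \<in> lev T k \<Longrightarrow>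
    pair T k (f + g) x = pair T k f x + pair T k g x"
  using tower by (simp add: is_dual_tower_def)

lemma pair_scale_left:
  "k < N \<Longrightarrow> f \<in> lev T (Suc k) \<Longrightarrow> x \<in> lev T k \<Longrightarrow> pair T k (sX c f) x = c * pair T k f x"
  using tower by (simp add: is_dual_tower_def)

lemma pair_zero_left: "k < N \<Longrightarrow> x \<in> lev T k \<Longrightarrow> pair T k 0 x = 0"
  using pair_scale_left[of k 0 x 0] level_zero[of "Suc k"] by simp

lemma pair_add_right:
  "k < N \<Longrightarrow> f \<in> lev T (Suc k) \<Longrightarrow> x \<in> lev T k \<Longrightarrow> y \<in> lev T k \<Longrightarrow>
    pair T k f (x + y) = pair T k f x + pair T k f y"
  using pair_bounded_functional by (simp add: bounded_functional_def)

lemma pair_scale_right: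
  "k < N \<Longrightarrow> f \<in> lev T (Suc k) \<Longrightarrow> x \<in> lev T k \<Longrightarrow> pair T k f (sX c x) = c * pair T k f x"
  using pair_bounded_functional by (simp add: bounded_functional_def)

lemma pair_zero_right: "k < N \<Longrightarrow> f \<in> lev T (Suc k) \<Longrightarrow> pair T k f 0 = 0"
  using pair_scale_right[of k f 0 0] level_zero[of k] by simp

lemma functional_eq_zero:
  assumes "k < N" "\<And>x. x \<in> lev T k \<Longrightarrow> \<phi> x = 0"
  shows "functional T k \<phi> = 0"
  using assms by (intro functional_eqI[OF tower]) (auto simp: level_zero pair_zero_left)

section \<open>Dual norms and adjoints of bounded maps\<close>

text \<open>
  A dual norm is defined as a supremum of reals, which carries information only once the set is known
  to be bounded above. The boundedness comes from the functional being bounded with respect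
  to the norm one level below, whose nonnegativity is needed, so the facts are proved together.
\<close>

lemma level_norm_nonneg_scale_bdd:
  assumes "k \<le> N" "x \<in> lev T k"
  shows "0 \<le> level_norm nrm T k x \<and> level_norm nrm T k (sX c x) \<le> norm c * level_norm nrm T k x
    \<and> (\<forall>j. k = Suc j \<longrightarrow> bdd_above ((\<lambda>z. norm (pair T j x z)) ` {z \<in> lev T j. level_norm nrm T j z \<le> 1}))"
  using assms
proof (induction k arbitrary: x c)
  case 0
  then obtain v where "x = emb T v" using level_0 by auto
  moreover have "sX c (emb T v) = emb T (sV c v)" by (simp add: emb.scale)
  ultimately show ?case by (simp add: nrm_nonneg nrm_scale)
next
  case (Suc k)
  let ?U = "{z \<in> lev T k. level_norm nrm T k z \<le> 1}"
  have k: "k < N" using Suc.prems by simp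
  have nonneg: "0 \<le> level_norm nrm T k z" if "z \<in> lev T k" for z
    using Suc.IH k that by simp
  have zero: "0 \<in> ?U"
    using Suc.IH[of 0 0] level_zero[of k] k by simp
  have bdd: "bdd_above ((\<lambda>z. norm (pair T k f z)) ` ?U)" if f: "f \<in> lev T (Suc k)" for f
  proof -
    obtain M where M: "\<And>z. z \<in> lev T k \<Longrightarrow> norm (pair T k f z) \<le> M * level_norm nrm T k z"
      using pair_bounded_functional[OF k f] unfolding bounded_functional_def by blast
    have "norm (pair T k f z) \<le> \<bar>M\<bar>" if "z \<in> ?U" for z
    proof -
      have "norm (pair T k f z) \<le> M * level_norm nrm T k z" using M that by simp
      also have "\<dots> \<le> \<bar>M\<bar> * 1" using nonneg[of z] that by (intro mult_mono) auto
      finally show ?thesis by simp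
    qed
    then show ?thesis by (rule bdd_aboveI2)
  qed
  have le: "norm (pair T k x z) \<le> level_norm nrm T (Suc k) x" if "z \<in> ?U" for z
    using bdd[OF Suc.prems(2)] that by (auto simp only: level_norm.simps intro!: cSUP_upper)
  have "0 \<le> level_norm nrm T (Suc k) x"
    using le[OF zero] norm_ge_zero order_trans by blast
  moreover have "level_norm nrm T (Suc k) (sX c x) \<le> norm c * level_norm nrm T (Suc k) x"
    unfolding level_norm.simps(2)[where f = "sX c x"]
  proof (rule cSUP_least)
    fix z assume z: "z \<in> ?U"
    have "norm (pair T k (sX c x) z) = norm c * norm (pair T k x z)"
      using z k Suc.prems by (simp add: pair_scale_left norm_mult)
    also have "\<dots> \<le> norm c * level_norm nrm T (Suc k) x"
      using le[OF z] by (rule mult_left_mono) simp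
    finally show "norm (pair T k (sX c x) z) \<le> norm c * level_norm nrm T (Suc k) x" .
  qed (use zero in blast)
  ultimately show ?case using bdd[OF Suc.prems(2)] by (simp del: level_norm.simps)
qed

lemma level_norm_nonneg: "k \<le> N \<Longrightarrow> x \<in> lev T k \<Longrightarrow> 0 \<le> level_norm nrm T k x"
  using level_norm_nonneg_scale_bdd by blast

lemma level_norm_scale:
  "k \<le> N \<Longrightarrow> x \<in> lev T k \<Longrightarrow> level_norm nrm T k (sX c x) \<le> norm c * level_norm nrm T k x"
  using level_norm_nonneg_scale_bdd by blast

lemma norm_pair_le_level_norm:
  assumes "k < N" "f \<in> lev T (Suc k)" "z \<in> lev T k" "level_norm nrm T k z \<le> 1"
  shows "norm (pair T k f z) \<le> level_norm nrm T (Suc k) f"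
proof -
  have "bdd_above ((\<lambda>z. norm (pair T k f z)) ` {z \<in> lev T k. level_norm nrm T k z \<le> 1})"
    using level_norm_nonneg_scale_bdd[of "Suc k" f] assms by simp
  then show ?thesis unfolding level_norm.simps using assms by (intro cSUP_upper) auto
qed

lemma level_norm_zero: "k \<le> N \<Longrightarrow> level_norm nrm T k 0 \<le> 0"
  using level_norm_scale[of k 0 0] level_zero[of k] by simp

lemma level_norm_leI:
  assumes "k < N"
    and "\<And>z. z \<in> lev T k \<Longrightarrow> level_norm nrm T k z \<le> 1 \<Longrightarrow> norm (pair T k f z) \<le> C"
  shows "level_norm nrm T (Suc k) f \<le> C"
proof -
  have "0 \<in> {z \<in> lev T k. level_norm nrm T k z \<le> 1}"
    using level_zero[of k] level_norm_zero[of k] assms(1) by simp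
  then show ?thesis unfolding level_norm.simps using assms(2) by (intro cSUP_least) auto
qed

end

text \<open>Bounded linear maps between levels. A positive bound is asked for so that one can divide by it.\<close>

definition level_map ::
    "('k::real_normed_field \<Rightarrow> 'x::ab_group_add \<Rightarrow> 'x) \<Rightarrow> ('v \<Rightarrow> real) \<Rightarrow> ('v, 'x, 'k) tower \<Rightarrow> nat
      \<Rightarrow> ('k \<Rightarrow> 'y::ab_group_add \<Rightarrow> 'y) \<Rightarrow> ('w \<Rightarrow> real) \<Rightarrow> ('w, 'y, 'k) tower \<Rightarrow> nat
      \<Rightarrow> ('x \<Rightarrow> 'y) \<Rightarrow> bool" where
  "level_map sX nV S k sY nW T j \<phi> \<longleftrightarrow>
     (\<forall>x\<in>lev S k. \<phi> x \<in> lev T j)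
     \<and> (\<forall>x\<in>lev S k. \<forall>y\<in>lev S k. \<phi> (x + y) = \<phi> x + \<phi> y)
     \<and> (\<forall>c. \<forall>x\<in>lev S k. \<phi> (sX c x) = sY c (\<phi> x))
     \<and> (\<exists>M>0. \<forall>x\<in>lev S k. level_norm nW T j (\<phi> x) \<le> M * level_norm nV S k x)"

lemma level_map_in: "level_map sX nV S k sY nW T j \<phi> \<Longrightarrow> x \<in> lev S k \<Longrightarrow> \<phi> x \<in> lev T j"
  by (simp add: level_map_def)

text \<open>
  The adjoint \<open>\<phi>\<^sup>*\<close> of a bounded map \<open>\<phi>\<close> with bound \<open>M\<close> is again bounded by \<open>M\<close>: if
  \<open>\<parallel>z\<parallel> \<le> 1\<close> then \<open>\<phi> z / M\<close> lies in the unit ball, where \<open>f\<close> is at most \<open>\<parallel>f\<parallel>\<close>.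
\<close>

lemma level_map_adjoint:
  assumes S: "normed_dual_tower sV nV sX N S" and T: "normed_dual_tower sW nW sY N' T"
    and k: "k < N" and j: "j < N'" and \<phi>: "level_map sX nV S k sY nW T j \<phi>"
  defines "adj \<equiv> \<lambda>f. functional S k (\<lambda>x. pair T j f (\<phi> x))"
  shows "level_map sY nW T (Suc j) sX nV S (Suc k) adj"
    and "f \<in> lev T (Suc j) \<Longrightarrow> x \<in> lev S k \<Longrightarrow> pair S k (adj f) x = pair T j f (\<phi> x)"
proof -
  interpret S: normed_dual_tower sV nV sX N S by fact
  interpret T: normed_dual_tower sW nW sY N' T by fact
  from \<phi> obtain M where M: "M > 0"
      "\<And>x. x \<in> lev S k \<Longrightarrow> level_norm nW T j (\<phi> x) \<le> M * level_norm nV S k x"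
    and into: "\<And>x. x \<in> lev S k \<Longrightarrow> \<phi> x \<in> lev T j"
    and add: "\<And>x y. x \<in> lev S k \<Longrightarrow> y \<in> lev S k \<Longrightarrow> \<phi> (x + y) = \<phi> x + \<phi> y"
    and scale: "\<And>c x. x \<in> lev S k \<Longrightarrow> \<phi> (sX c x) = sY c (\<phi> x)"
    unfolding level_map_def by blast
  have bf: "bounded_functional sX (lev S k) (level_norm nV S k) (\<lambda>x. pair T j f (\<phi> x))"
    if f: "f \<in> lev T (Suc j)" for f
  proof -
    obtain C where C: "\<And>z. z \<in> lev T j \<Longrightarrow> norm (pair T j f z) \<le> C * level_norm nW T j z"
      using T.pair_bounded_functional[OF j f] unfolding bounded_functional_def by blast
    have "norm (pair T j f (\<phi> x)) \<le> (\<bar>C\<bar> * M) * level_norm nV S k x" if x: "x \<in> lev S k" for x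
    proof -
      have "norm (pair T j f (\<phi> x)) \<le> C * level_norm nW T j (\<phi> x)" using C into x by blast
      also have "\<dots> \<le> \<bar>C\<bar> * (M * level_norm nV S k x)"
        using M(2)[OF x] T.level_norm_nonneg[OF _ into[OF x]] j by (intro mult_mono) auto
      finally show ?thesis by (simp add: mult.assoc)
    qed
    then show ?thesis using f j into add scale
      by (auto simp: bounded_functional_def T.pair_add_right T.pair_scale_right)
  qed
  have adj_in: "adj f \<in> lev S (Suc k)"
    and adj_pair: "x \<in> lev S k \<Longrightarrow> pair S k (adj f) x = pair T j f (\<phi> x)"
    if "f \<in> lev T (Suc j)" for f x
    unfolding adj_def using functional_in_level[OF S.tower k bf[OF that]] by auto
  have "adj (f + g) = adj f + adj g" if "f \<in> lev T (Suc j)" "g \<in> lev T (Suc j)" for f g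
    using that k j S.level_add[of "Suc k"] T.level_add[of "Suc j"]
    by (intro level_eqI[OF S.tower k])
      (auto simp: adj_in adj_pair S.pair_add_left T.pair_add_left into)
  moreover have "adj (sY c f) = sX c (adj f)" if "f \<in> lev T (Suc j)" for c f
    using that k j S.level_scale[of "Suc k"] T.level_scale[of "Suc j"]
    by (intro level_eqI[OF S.tower k])
      (auto simp: adj_in adj_pair S.pair_scale_left T.pair_scale_left into)
  moreover have "level_norm nV S (Suc k) (adj f) \<le> M * level_norm nW T (Suc j) f"
    if f: "f \<in> lev T (Suc j)" for f
  proof (rule S.level_norm_leI[OF k])
    fix z assume z: "z \<in> lev S k" "level_norm nV S k z \<le> 1"
    define w where "w = sY (of_real (1 / M)) (\<phi> z)"
    have w: "w \<in> lev T j" unfolding w_def using T.level_scale[of j] into[OF z(1)] j by simp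
    have "level_norm nW T j w \<le> (1 / M) * level_norm nW T j (\<phi> z)"
      unfolding w_def using T.level_norm_scale[of j "\<phi> z" "of_real (1 / M)"] into[OF z(1)] j M(1)
      by (simp add: norm_divide)
    also have "\<dots> \<le> (1 / M) * M"
    proof -
      have "M * level_norm nV S k z \<le> M * 1" using z(2) M(1) by (intro mult_left_mono) auto
      then have "level_norm nW T j (\<phi> z) \<le> M" using M(2)[OF z(1)] by simp
      then show ?thesis using M(1) by (intro mult_left_mono) auto
    qed
    finally have unit: "level_norm nW T j w \<le> 1" using M(1) by simp
    have "pair T j f w = of_real (1 / M) * pair T j f (\<phi> z)"
      unfolding w_def using T.pair_scale_right[OF j f into[OF z(1)]] .
    then have "norm (pair T j f (\<phi> z)) = M * norm (pair T j f w)"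
      using M(1) by (simp add: norm_mult norm_divide)
    also have "\<dots> \<le> M * level_norm nW T (Suc j) f"
      using T.norm_pair_le_level_norm[OF j f w unit] M(1) by (intro mult_left_mono) auto
    finally show "norm (pair S k (adj f) z) \<le> M * level_norm nW T (Suc j) f"
      using adj_pair[OF f z(1)] by simp
  qed
  ultimately show "level_map sY nW T (Suc j) sX nV S (Suc k) adj"
    using adj_in M(1) unfolding level_map_def by blast
  show "f \<in> lev T (Suc j) \<Longrightarrow> x \<in> lev S k \<Longrightarrow> pair S k (adj f) x = pair T j f (\<phi> x)"
    by (rule adj_pair)
qed

lemma level_map_0:
  assumes S: "normed_dual_tower sV nV sX N S" and T: "normed_dual_tower sW nW sY N' T"
    and add: "\<And>u v. h (u + v) = h u + h v" and scale: "\<And>c v. h (sV c v) = sW c (h v)"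
    and bound: "\<And>v. nW (h v) \<le> nV v * C"
  shows "level_map sX nV S 0 sY nW T 0 (\<lambda>x. emb T (h (inv (emb S) x)))"
proof -
  interpret S: normed_dual_tower sV nV sX N S by fact
  interpret T: normed_dual_tower sW nW sY N' T by fact
  \<comment> \<open>Adding \<open>1\<close> makes the bound positive, even when \<open>h\<close> vanishes.\<close>
  have bound': "nW (h v) \<le> (\<bar>C\<bar> + 1) * nV v" for v
  proof -
    have "nV v * C \<le> nV v * (\<bar>C\<bar> + 1)" using S.nrm_nonneg by (intro mult_left_mono) auto
    then show ?thesis using bound[of v] by (simp add: mult.commute)
  qed
  have "\<exists>M>0. \<forall>x\<in>lev S 0. level_norm nW T 0 (emb T (h (inv (emb S) x))) \<le> M * level_norm nV S 0 x"
    by (rule exI[of _ "\<bar>C\<bar> + 1"]) (use bound' in \<open>auto simp: S.level_0\<close>)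
  moreover have "emb T (h (inv (emb S) (emb S u + emb S v))) = emb T (h u) + emb T (h v)" for u v
    by (simp add: S.emb.add[symmetric] T.emb.add[symmetric] add)
  moreover have "emb T (h (inv (emb S) (sX c (emb S v)))) = sY c (emb T (h v))" for c v
    by (simp add: S.emb.scale[symmetric] T.emb.scale[symmetric] scale)
  ultimately show ?thesis by (auto simp: level_map_def S.level_0 T.level_0)
qed

section \<open>Actions on the duals\<close>

text \<open>A right action is covered by exchanging its arguments.\<close>

definition bounded_action :: "('k \<Rightarrow> 'v::real_normed_vector \<Rightarrow> 'v) \<Rightarrow> ('c::real_normed_vector \<Rightarrow> 'v \<Rightarrow> 'v) \<Rightarrow> bool" where
  "bounded_action sV l \<longleftrightarrow> bounded_bilinear l \<and> (\<forall>c s v. l c (sV s v) = sV s (l c v))"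

text \<open>
  The left action on one level is the adjoint of the right action on the level below and conversely,
  so their boundedness has to be carried up the tower jointly.
\<close>

lemma level_map_lact_ract:
  fixes T :: "('v::real_normed_vector, 'x::ab_group_add, 'k::real_normed_field) tower"
  assumes T: "normed_dual_tower sV norm sX N T"
    and l: "bounded_action sV l" and r: "bounded_action sV (\<lambda>c v. r v c)"
    and "k \<le> N"
  shows "level_map sX norm T k sX norm T k (lact T l r k c)
    \<and> level_map sX norm T k sX norm T k (\<lambda>x. ract T l r k x c)"
  using \<open>k \<le> N\<close>
proof (induction k)
  case 0
  interpret l: bounded_bilinear l using l by (simp add: bounded_action_def)
  interpret r: bounded_bilinear "\<lambda>c v. r v c" using r by (simp add: bounded_action_def)
  obtain K where "\<And>v. norm (l c v) \<le> norm v * K"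
    using bounded_linear.bounded[OF l.bounded_linear_right] by blast
  moreover obtain K' where "\<And>v. norm (r v c) \<le> norm v * K'"
    using bounded_linear.bounded[OF r.bounded_linear_right] by blast
  ultimately show ?case
    using l r unfolding bounded_action_def lact.simps ract.simps
    by (auto intro!: level_map_0[OF T T] simp: l.add_right r.add_right)
next
  case (Suc k)
  then show ?case
    using level_map_adjoint(1)[OF T T, of k k] by simp
qed

text \<open>
  These are the defining identities of a dual bimodule. They hold because the functionals on the
  right-hand sides are bounded, hence represented by elements of the dual.
\<close>

lemma pair_lact_ract:
  fixes T :: "('v::real_normed_vector, 'x::ab_group_add, 'k::real_normed_field) tower"
  assumes "normed_dual_tower sV norm sX N T"
    and "bounded_action sV l" and "bounded_action sV (\<lambda>c v. r v c)"
    and "k < N" "f \<in> lev T (Suc k)" "x \<in> lev T k"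
  shows "pair T k (lact T l r (Suc k) c f) x = pair T k f (ract T l r k x c)"
    and "pair T k (ract T l r (Suc k) f c) x = pair T k f (lact T l r k c x)"
  using level_map_adjoint(2)[OF assms(1,1,4,4)] level_map_lact_ract[OF assms(1-3), of k c] assms
  by simp_all

lemma lact_ract_in_level:
  fixes T :: "('v::real_normed_vector, 'x::ab_group_add, 'k::real_normed_field) tower"
  assumes "normed_dual_tower sV norm sX N T"
    and "bounded_action sV l" and "bounded_action sV (\<lambda>c v. r v c)"
    and "k \<le> N" "x \<in> lev T k"
  shows "lact T l r k c x \<in> lev T k" and "ract T l r k x c \<in> lev T k"
  using level_map_lact_ract[OF assms(1-4), of c] assms(5) level_map_in by blast+

lemma lact_ract_zero:
  fixes T :: "('v::real_normed_vector, 'x::ab_group_add, 'k::real_normed_field) tower"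
  assumes T: "normed_dual_tower sV norm sX N T"
    and l: "bounded_action sV l" and r: "bounded_action sV (\<lambda>c v. r v c)"
    and "k \<le> N" "x \<in> lev T k"
  shows "lact T l r k 0 x = 0 \<and> ract T l r k x 0 = 0"
  using assms(4,5)
proof (induction k arbitrary: x)
  interpret T: normed_dual_tower sV norm sX N T by fact
  interpret l: bounded_bilinear l using l by (simp add: bounded_action_def)
  interpret r: bounded_bilinear "\<lambda>c v. r v c" using r by (simp add: bounded_action_def)
  case 0
  show ?case by (simp add: l.zero_left r.zero_left T.emb.zero)
next
  interpret T: normed_dual_tower sV norm sX N T by fact
  case (Suc k)
  then show ?case by (auto intro!: T.functional_eq_zero simp: T.pair_zero_right)
qed

section \<open>Mixed operations\<close>

text \<open>
  The operations built from the left action are those built from the right action after passing to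
  the opposite action, so the properties are only proved for one of the two families.
\<close>

lemma bul_even_eq_tri_even:
  "bul_even TA TB l m y a = tri_even TA TB (\<lambda>a \<beta>. l \<beta> a) m a y"
proof (induction m arbitrary: y)
  case (Suc m)
  then show ?case by simp
qed simp

lemma tri_odd_eq_bul_odd: "tri_odd TA TB l m a x = bul_odd TA TB (\<lambda>a \<beta>. l \<beta> a) m x a"
  by (simp add: bul_even_eq_tri_even)

declare bul_odd.simps [simp del] tri_odd.simps [simp del]

text \<open>
  In the mixed operations the partial map \<open>r a\<close> from \<open>'b\<close> to \<open>'a\<close> is dualised again and again,
  so that its iterated adjoints run alternately between the two towers.
\<close>

locale mixed_towers =
  A: normed_dual_tower sA norm sX N TA + B: normed_dual_tower sB norm sY N TB
  for sA :: "'k::real_normed_field \<Rightarrow> 'a::real_normed_vector \<Rightarrow> 'a"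
    and sB :: "'k \<Rightarrow> 'b::real_normed_vector \<Rightarrow> 'b"
    and sX :: "'k \<Rightarrow> 'x::ab_group_add \<Rightarrow> 'x" and sY :: "'k \<Rightarrow> 'y::ab_group_add \<Rightarrow> 'y"
    and N TA TB +
  fixes r :: "'a \<Rightarrow> 'b \<Rightarrow> 'a"
  assumes r_bilinear: "bounded_bilinear r"
    and r_scale: "r a (sB c \<beta>) = sA c (r a \<beta>)"
begin

interpretation r: bounded_bilinear r by (rule r_bilinear)

lemma level_map_bul_odd_step:
  assumes "2 * m < N" "level_map sY norm TB (2 * m) sX norm TA (2 * m) (tri_even TA TB r m a)"
  shows "level_map sX norm TA (2 * m + 1) sY norm TB (2 * m + 1) (\<lambda>x. bul_odd TA TB r m x a)"
  using level_map_adjoint(1)[OF B.normed_dual_tower_axioms A.normed_dual_tower_axioms assms(1,1,2)]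
  by (simp add: bul_odd.simps)

lemma level_map_tri_even:
  "2 * m \<le> N \<Longrightarrow> level_map sY norm TB (2 * m) sX norm TA (2 * m) (tri_even TA TB r m a)"
proof (induction m)
  case 0
  obtain K where "\<And>\<beta>. norm (r a \<beta>) \<le> norm \<beta> * K"
    using bounded_linear.bounded[OF r.bounded_linear_right] by blast
  then show ?case
    by (auto intro!: level_map_0[OF B.normed_dual_tower_axioms A.normed_dual_tower_axioms]
        simp: r.add_right r_scale)
next
  case (Suc m)
  then have "level_map sX norm TA (2 * m + 1) sY norm TB (2 * m + 1) (\<lambda>x. bul_odd TA TB r m x a)"
    by (intro level_map_bul_odd_step) auto
  from level_map_adjoint(1)[OF A.normed_dual_tower_axioms B.normed_dual_tower_axioms _ _ this]
  show ?case using Suc.prems by simp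
qed

lemma level_map_bul_odd:
  "2 * m < N \<Longrightarrow>
    level_map sX norm TA (2 * m + 1) sY norm TB (2 * m + 1) (\<lambda>x. bul_odd TA TB r m x a)"
  using level_map_tri_even by (intro level_map_bul_odd_step) auto

lemma tri_even_in_level: "2 * m \<le> N \<Longrightarrow> y \<in> lev TB (2 * m) \<Longrightarrow> tri_even TA TB r m a y \<in> lev TA (2 * m)"
  using level_map_tri_even level_map_in by blast

lemma bul_odd_in_level:
  "2 * m < N \<Longrightarrow> x \<in> lev TA (Suc (2 * m)) \<Longrightarrow> bul_odd TA TB r m x a \<in> lev TB (Suc (2 * m))"
  using level_map_in[OF level_map_bul_odd] by simp

lemma pair_bul_odd:
  assumes "2 * m < N" "x \<in> lev TA (Suc (2 * m))" "y \<in> lev TB (2 * m)"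
  shows "pair TB (2 * m) (bul_odd TA TB r m x a) y = pair TA (2 * m) x (tri_even TA TB r m a y)"
  using level_map_adjoint(2)[OF B.normed_dual_tower_axioms A.normed_dual_tower_axioms _ _
      level_map_tri_even] assms
  by (simp add: bul_odd.simps)

lemma pair_tri_even_Suc:
  assumes "Suc (2 * m) < N" "y \<in> lev TB (Suc (Suc (2 * m)))" "x \<in> lev TA (Suc (2 * m))"
  shows "pair TA (Suc (2 * m)) (tri_even TA TB r (Suc m) a y) x
    = pair TB (Suc (2 * m)) y (bul_odd TA TB r m x a)"
  using level_map_adjoint(2)[OF A.normed_dual_tower_axioms B.normed_dual_tower_axioms _ _
      level_map_bul_odd] assms
  by simp

lemma bul_odd_zero:
  assumes "2 * m < N" "x \<in> lev TA (Suc (2 * m))"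
  shows "bul_odd TA TB r m x 0 = 0"
  using assms
proof (induction m arbitrary: x)
  case 0
  have "tri_even TA TB r 0 0 y = 0" for y by (simp add: r.zero_left A.emb.zero)
  then show ?case using 0 A.pair_zero_right[of 0 x]
    by (simp add: bul_odd.simps B.functional_eq_zero del: tri_even.simps)
next
  case (Suc m)
  have "tri_even TA TB r (Suc m) 0 y = 0" if y: "y \<in> lev TB (Suc (Suc (2 * m)))" for y
  proof -
    have "pair TB (Suc (2 * m)) y (bul_odd TA TB r m u 0) = 0" if "u \<in> lev TA (Suc (2 * m))" for u
      using Suc that y by (simp add: B.pair_zero_right)
    then show ?thesis using Suc.prems by (simp add: A.functional_eq_zero)
  qed
  then show ?case using Suc.prems
    by (simp add: bul_odd.simps A.pair_zero_right B.functional_eq_zero del: tri_even.simps)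
qed

end

section \<open>The duals of the amalgamated duplication\<close>

locale amalgamated_towers =
  A: normed_dual_tower sA norm sX N TA + B: normed_dual_tower sB norm sY N TB
  for sA :: "'k::real_normed_field \<Rightarrow> 'a::real_normed_algebra \<Rightarrow> 'a"
    and sB :: "'k \<Rightarrow> 'b::real_normed_algebra \<Rightarrow> 'b"
    and sX :: "'k \<Rightarrow> 'x::ab_group_add \<Rightarrow> 'x" and sY :: "'k \<Rightarrow> 'y::ab_group_add \<Rightarrow> 'y"
    and N TA TB +
  fixes l :: "'b \<Rightarrow> 'a \<Rightarrow> 'a" and r :: "'a \<Rightarrow> 'b \<Rightarrow> 'a"
  assumes algebra_A: "normed_algebra_scale sA" and algebra_B: "normed_algebra_scale sB"
    and bimodule: "banach_bimodule sB sA l r"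
begin

lemma bounded_actions:
  "bounded_action sA ((*) :: 'a \<Rightarrow> _)" "bounded_action sA (\<lambda>c v::'a. v * c)"
  "bounded_action sB ((*) :: 'b \<Rightarrow> _)" "bounded_action sB (\<lambda>c v::'b. v * c)"
  "bounded_action sA l" "bounded_action sA (\<lambda>\<beta> u. r u \<beta>)"
  using algebra_A algebra_B bimodule bounded_bilinear.flip[OF bounded_bilinear_mult]
    bounded_bilinear.flip[of r]
  by (auto simp: bounded_action_def normed_algebra_scale_def banach_bimodule_def
      bounded_bilinear_mult)

sublocale R: mixed_towers sA sB sX sY N TA TB r
  using bimodule
  by (intro mixed_towers.intro mixed_towers_axioms.intro A.normed_dual_tower_axioms
      B.normed_dual_tower_axioms) (auto simp: banach_bimodule_def)

sublocale L: mixed_towers sA sB sX sY N TA TB "\<lambda>a \<beta>. l \<beta> a"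
  using bimodule bounded_bilinear.flip[of l]
  by (intro mixed_towers.intro mixed_towers_axioms.intro A.normed_dual_tower_axioms
      B.normed_dual_tower_axioms) (auto simp: banach_bimodule_def)

lemmas lact_ract_in_levels =
  lact_ract_in_level[OF A.normed_dual_tower_axioms bounded_actions(1,2)]
  lact_ract_in_level[OF A.normed_dual_tower_axioms bounded_actions(5,6)]
  lact_ract_in_level[OF B.normed_dual_tower_axioms bounded_actions(3,4)]

lemmas pair_lact_racts =
  pair_lact_ract[OF A.normed_dual_tower_axioms bounded_actions(1,2)]
  pair_lact_ract[OF A.normed_dual_tower_axioms bounded_actions(5,6)]
  pair_lact_ract[OF B.normed_dual_tower_axioms bounded_actions(3,4)]

lemmas lact_ract_zeros =
  lact_ract_zero[OF A.normed_dual_tower_axioms bounded_actions(1,2)]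
  lact_ract_zero[OF A.normed_dual_tower_axioms bounded_actions(5,6)]
  lact_ract_zero[OF B.normed_dual_tower_axioms bounded_actions(3,4)]

abbreviation P where "P \<equiv> prod_tower TA TB"
abbreviation mul where "mul \<equiv> amalg_mult l r"

lemma prod_tower_sel:
  "lev P k = lev TA k \<times> lev TB k"
  "pair P k f z = pair TA k (fst f) (fst z) + pair TB k (snd f) (snd z)"
  by (simp_all add: prod_tower_def)

lemmas prod_tower_functional_eqI =
  functional_eqI[OF is_dual_tower_prod[OF A.tower B.tower]]

lemma inv_emb_prod: "inv (emb P) (emb TA a, emb TB \<beta>) = (a, \<beta>)"
proof -
  have "inj (emb P)"
    using is_dual_tower_prod[OF A.tower B.tower] by (simp add: is_dual_tower_def)
  moreover have "(emb TA a, emb TB \<beta>) = emb P (a, \<beta>)" by (simp add: prod_tower_def)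
  ultimately show ?thesis by (metis inv_f_f)
qed

text \<open>
  Because the pairing is coordinatewise, passing to the adjoint transposes the triangular matrix of
  operators: on even levels the mixed operation feeds the second coordinate into the first, on odd
  levels the first into the second. The formulas for the even level are assumed, since the step is
  also used inside the induction that establishes them.
\<close>

lemma prod_tower_odd_step:
  assumes m: "2 * m < N"
    and even_l: "\<And>a \<beta> u w. u \<in> lev TA (2 * m) \<Longrightarrow> w \<in> lev TB (2 * m) \<Longrightarrow>
      lact P mul mul (2 * m) (a, \<beta>) (u, w) =
        (lact TA (*) (*) (2 * m) a u + lact TA l r (2 * m) \<beta> u + tri_even TA TB r m a w,
         lact TB (*) (*) (2 * m) \<beta> w)"
    and even_r: "\<And>a \<beta> u w. u \<in> lev TA (2 * m) \<Longrightarrow> w \<in> lev TB (2 * m) \<Longrightarrow>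
      ract P mul mul (2 * m) (u, w) (a, \<beta>) =
        (ract TA (*) (*) (2 * m) u a + ract TA l r (2 * m) u \<beta> + bul_even TA TB l m w a,
         ract TB (*) (*) (2 * m) w \<beta>)"
    and f: "f \<in> lev TA (Suc (2 * m))" and g: "g \<in> lev TB (Suc (2 * m))"
  shows "lact P mul mul (Suc (2 * m)) (a, \<beta>) (f, g) =
      (lact TA (*) (*) (Suc (2 * m)) a f + lact TA l r (Suc (2 * m)) \<beta> f,
       tri_odd TA TB l m a f + lact TB (*) (*) (Suc (2 * m)) \<beta> g)" (is "_ = ?L")
    and "ract P mul mul (Suc (2 * m)) (f, g) (a, \<beta>) =
      (ract TA (*) (*) (Suc (2 * m)) f a + ract TA l r (Suc (2 * m)) f \<beta>,
       bul_odd TA TB r m f a + ract TB (*) (*) (Suc (2 * m)) g \<beta>)" (is "_ = ?R")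
proof -
  note facts = prod_tower_sel even_l even_r bul_even_eq_tri_even tri_odd_eq_bul_odd
    lact_ract_in_levels A.level_add B.level_add pair_lact_racts
    A.pair_add_left B.pair_add_left A.pair_add_right B.pair_add_right
    R.tri_even_in_level L.tri_even_in_level R.bul_odd_in_level L.bul_odd_in_level
    R.pair_bul_odd L.pair_bul_odd
  show "lact P mul mul (Suc (2 * m)) (a, \<beta>) (f, g) = ?L"
    unfolding lact.simps(2)[of P]
    by (rule prod_tower_functional_eqI) (use m f g in \<open>auto simp del: lact.simps ract.simps simp: facts\<close>)
  show "ract P mul mul (Suc (2 * m)) (f, g) (a, \<beta>) = ?R"
    unfolding ract.simps(2)[of P]
    by (rule prod_tower_functional_eqI) (use m f g in \<open>auto simp del: lact.simps ract.simps simp: facts\<close>)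
qed

lemma prod_tower_even_actions:
  assumes "2 * m \<le> N" "u \<in> lev TA (2 * m)" "w \<in> lev TB (2 * m)"
  shows "lact P mul mul (2 * m) (a, \<beta>) (u, w) =
        (lact TA (*) (*) (2 * m) a u + lact TA l r (2 * m) \<beta> u + tri_even TA TB r m a w,
         lact TB (*) (*) (2 * m) \<beta> w)
    \<and> ract P mul mul (2 * m) (u, w) (a, \<beta>) =
        (ract TA (*) (*) (2 * m) u a + ract TA l r (2 * m) u \<beta> + bul_even TA TB l m w a,
         ract TB (*) (*) (2 * m) w \<beta>)"
  using assms
proof (induction m arbitrary: a \<beta> u w)
  case 0
  then obtain v \<gamma> where "u = emb TA v" "w = emb TB \<gamma>"
    using A.level_0 B.level_0 by auto
  then show ?case
    by (simp add: inv_emb_prod amalg_mult_def) (simp add: prod_tower_def A.emb.add algebra_simps)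
next
  case (Suc m)
  have m: "Suc (2 * m) < N" and u: "u \<in> lev TA (Suc (Suc (2 * m)))" and w: "w \<in> lev TB (Suc (Suc (2 * m)))"
    using Suc.prems by auto
  have IH: "lact P mul mul (2 * m) (a, \<beta>) (u, w) =
        (lact TA (*) (*) (2 * m) a u + lact TA l r (2 * m) \<beta> u + tri_even TA TB r m a w,
         lact TB (*) (*) (2 * m) \<beta> w)"
    "ract P mul mul (2 * m) (u, w) (a, \<beta>) =
        (ract TA (*) (*) (2 * m) u a + ract TA l r (2 * m) u \<beta> + bul_even TA TB l m w a,
         ract TB (*) (*) (2 * m) w \<beta>)"
    if "u \<in> lev TA (2 * m)" "w \<in> lev TB (2 * m)" for a \<beta> u w
    using Suc.IH[of u w a \<beta>] that m by simp_all
  note odd = prod_tower_odd_step[OF Suc_lessD[OF m] IH]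
  note facts = prod_tower_sel odd bul_even_eq_tri_even tri_odd_eq_bul_odd
    lact_ract_in_levels A.level_add B.level_add pair_lact_racts
    A.pair_add_left B.pair_add_left A.pair_add_right B.pair_add_right
    R.tri_even_in_level[of "Suc m", unfolded mult_Suc_right add_2_eq_Suc]
    L.tri_even_in_level[of "Suc m", unfolded mult_Suc_right add_2_eq_Suc]
    R.bul_odd_in_level L.bul_odd_in_level
    R.pair_tri_even_Suc L.pair_tri_even_Suc
  have "lact P mul mul (Suc (Suc (2 * m))) (a, \<beta>) (u, w) =
        (lact TA (*) (*) (Suc (Suc (2 * m))) a u + lact TA l r (Suc (Suc (2 * m))) \<beta> u
           + tri_even TA TB r (Suc m) a w,
         lact TB (*) (*) (Suc (Suc (2 * m))) \<beta> w)"
    unfolding lact.simps(2)[of P]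
    by (rule prod_tower_functional_eqI)
      (use m u w in \<open>auto simp del: lact.simps ract.simps tri_even.simps bul_even.simps simp: facts\<close>)
  moreover have "ract P mul mul (Suc (Suc (2 * m))) (u, w) (a, \<beta>) =
        (ract TA (*) (*) (Suc (Suc (2 * m))) u a + ract TA l r (Suc (Suc (2 * m))) u \<beta>
           + bul_even TA TB l (Suc m) w a,
         ract TB (*) (*) (Suc (Suc (2 * m))) w \<beta>)"
    unfolding ract.simps(2)[of P]
    by (rule prod_tower_functional_eqI)
      (use m u w in \<open>auto simp del: lact.simps ract.simps tri_even.simps bul_even.simps simp: facts\<close>)
  ultimately show ?case by (simp only: mult_Suc_right add_2_eq_Suc)
qed

lemmas prod_tower_odd_actions = prod_tower_odd_step[OF _
    prod_tower_even_actions[THEN conjunct1] prod_tower_even_actions[THEN conjunct2]]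

text \<open>
  Each coordinate of \<open>ad (x, y)\<close> is a function of \<open>a\<close> plus a function of \<open>\<beta>\<close>. A sum of this kind
  determines both summands once they are known to vanish at \<open>0\<close>.
\<close>

lemma prod_tower_ad:
  assumes m: "2 * m < N" and x: "x \<in> lev TA (2 * m + 1)" and y: "y \<in> lev TB (2 * m + 1)"
  shows "ad (lact P mul mul (2 * m + 1)) (ract P mul mul (2 * m + 1)) (x, y) (a, \<beta>) =
     (ad (lact TA (*) (*) (2 * m + 1)) (ract TA (*) (*) (2 * m + 1)) x a
        + ad (lact TA l r (2 * m + 1)) (ract TA l r (2 * m + 1)) x \<beta>,
      (tri_odd TA TB l m a x - bul_odd TA TB r m x a)
        + ad (lact TB (*) (*) (2 * m + 1)) (ract TB (*) (*) (2 * m + 1)) y \<beta>)"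
    and "ad (lact TA (*) (*) (2 * m + 1)) (ract TA (*) (*) (2 * m + 1)) x 0 = 0"
    and "ad (lact TA l r (2 * m + 1)) (ract TA l r (2 * m + 1)) x 0 = 0"
    and "ad (lact TB (*) (*) (2 * m + 1)) (ract TB (*) (*) (2 * m + 1)) y 0 = 0"
    and "tri_odd TA TB l m 0 x - bul_odd TA TB r m x 0 = 0"
proof -
  have x': "x \<in> lev TA (Suc (2 * m))" and y': "y \<in> lev TB (Suc (2 * m))" using x y by simp_all
  have "lact P mul mul (Suc (2 * m)) (a, \<beta>) (x, y) =
      (lact TA (*) (*) (Suc (2 * m)) a x + lact TA l r (Suc (2 * m)) \<beta> x,
       tri_odd TA TB l m a x + lact TB (*) (*) (Suc (2 * m)) \<beta> y)"
    "ract P mul mul (Suc (2 * m)) (x, y) (a, \<beta>) =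
      (ract TA (*) (*) (Suc (2 * m)) x a + ract TA l r (Suc (2 * m)) x \<beta>,
       bul_odd TA TB r m x a + ract TB (*) (*) (Suc (2 * m)) y \<beta>)"
    using m x' y' by (intro prod_tower_odd_actions; simp)+
  then show "ad (lact P mul mul (2 * m + 1)) (ract P mul mul (2 * m + 1)) (x, y) (a, \<beta>) =
     (ad (lact TA (*) (*) (2 * m + 1)) (ract TA (*) (*) (2 * m + 1)) x a
        + ad (lact TA l r (2 * m + 1)) (ract TA l r (2 * m + 1)) x \<beta>,
      (tri_odd TA TB l m a x - bul_odd TA TB r m x a)
        + ad (lact TB (*) (*) (2 * m + 1)) (ract TB (*) (*) (2 * m + 1)) y \<beta>)"
    by (simp add: ad_def algebra_simps del: lact.simps ract.simps)
  show "ad (lact TA (*) (*) (2 * m + 1)) (ract TA (*) (*) (2 * m + 1)) x 0 = 0"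
    "ad (lact TA l r (2 * m + 1)) (ract TA l r (2 * m + 1)) x 0 = 0"
    "ad (lact TB (*) (*) (2 * m + 1)) (ract TB (*) (*) (2 * m + 1)) y 0 = 0"
    using m x' y' by (simp_all add: ad_def lact_ract_zeros del: lact.simps ract.simps)
  show "tri_odd TA TB l m 0 x - bul_odd TA TB r m x 0 = 0"
    using m x' by (simp add: tri_odd_eq_bul_odd L.bul_odd_zero R.bul_odd_zero)
qed

end

theorem proposition4p2:
  fixes sA :: "'k::real_normed_field \<Rightarrow> 'a::{real_normed_algebra, banach} \<Rightarrow> 'a"
    and sB :: "'k \<Rightarrow> 'b::{real_normed_algebra, banach} \<Rightarrow> 'b"
    and l :: "'b \<Rightarrow> 'a \<Rightarrow> 'a" and r :: "'a \<Rightarrow> 'b \<Rightarrow> 'a"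
    and n :: nat
    and sX :: "'k \<Rightarrow> 'x::ab_group_add \<Rightarrow> 'x" and TA :: "('a, 'x, 'k) tower"
    and sY :: "'k \<Rightarrow> 'y::ab_group_add \<Rightarrow> 'y" and TB :: "('b, 'y, 'k) tower"
    and D :: "'a \<times> 'b \<Rightarrow> 'x \<times> 'y"
    and DA1 :: "'a \<Rightarrow> 'x" and DA2 :: "'a \<Rightarrow> 'y" and DB1 :: "'b \<Rightarrow> 'x" and DB2 :: "'b \<Rightarrow> 'y"
    and x :: 'x and y :: 'y
  defines "T \<equiv> prod_tower TA TB"
    and "mul \<equiv> amalg_mult l r"
  assumes "normed_algebra_scale sA" and "normed_algebra_scale sB"
    and "banach_bimodule sB sA l r" and "compatible_actions l r"
    and "is_dual_tower sA norm sX (2 * n + 1) TA"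
    and "is_dual_tower sB norm sY (2 * n + 1) TB"
    and "derivation (prod_scale sA sB) mul amalg_norm
           (prod_scale sX sY) (lev T (2 * n + 1)) (level_norm amalg_norm T (2 * n + 1))
           (lact T mul mul (2 * n + 1)) (ract T mul mul (2 * n + 1)) D"
    and "Vector_Spaces.linear sA sX DA1" and "Vector_Spaces.linear sA sY DA2"
    and "Vector_Spaces.linear sB sX DB1" and "Vector_Spaces.linear sB sY DB2"
    and "\<And>a \<beta>. D (a, \<beta>) = (DA1 a + DB1 \<beta>, DA2 a + DB2 \<beta>)"
    and "x \<in> lev TA (2 * n + 1)" and "y \<in> lev TB (2 * n + 1)"
  shows "D = ad (lact T mul mul (2 * n + 1)) (ract T mul mul (2 * n + 1)) (x, y)
    \<longleftrightarrow> DA1 = ad (lact TA (*) (*) (2 * n + 1)) (ract TA (*) (*) (2 * n + 1)) x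
      \<and> DB2 = ad (lact TB (*) (*) (2 * n + 1)) (ract TB (*) (*) (2 * n + 1)) y
      \<and> DB1 = ad (lact TA l r (2 * n + 1)) (ract TA l r (2 * n + 1)) x
      \<and> (\<forall>a. DA2 a = tri_odd TA TB l n a x - bul_odd TA TB r n x a)"
proof -
  interpret amalgamated_towers sA sB sX sY "2 * n + 1" TA TB l r
    using assms(3-8) by unfold_locales (auto simp: normed_algebra_scale_def)
  interpret DA1: Vector_Spaces.linear sA sX DA1 by fact
  interpret DA2: Vector_Spaces.linear sA sY DA2 by fact
  interpret DB1: Vector_Spaces.linear sB sX DB1 by fact
  interpret DB2: Vector_Spaces.linear sB sY DB2 by fact
  note D = \<open>\<And>a \<beta>. D (a, \<beta>) = (DA1 a + DB1 \<beta>, DA2 a + DB2 \<beta>)\<close>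
  define A1 where "A1 = ad (lact TA (*) (*) (2 * n + 1)) (ract TA (*) (*) (2 * n + 1)) x"
  define A2 where "A2 = (\<lambda>a. tri_odd TA TB l n a x - bul_odd TA TB r n x a)"
  define B1 where "B1 = ad (lact TA l r (2 * n + 1)) (ract TA l r (2 * n + 1)) x"
  define B2 where "B2 = ad (lact TB (*) (*) (2 * n + 1)) (ract TB (*) (*) (2 * n + 1)) y"
  define E where "E = ad (lact T mul mul (2 * n + 1)) (ract T mul mul (2 * n + 1)) (x, y)"
  have E: "E (a, \<beta>) = (A1 a + B1 \<beta>, A2 a + B2 \<beta>)" for a \<beta>
    unfolding E_def A1_def A2_def B1_def B2_def T_def mul_def
    using assms(15,16) by (intro prod_tower_ad(1)) auto
  have zero: "A1 0 = 0" "B1 0 = 0" "B2 0 = 0" "A2 0 = 0"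
    unfolding A1_def A2_def B1_def B2_def
    using assms(15,16) prod_tower_ad(2-5)[of n x y] by simp_all
  have "D = E \<longleftrightarrow> DA1 = A1 \<and> DB2 = B2 \<and> DB1 = B1 \<and> (\<forall>a. DA2 a = A2 a)"
  proof
    assume eq: "D = E"
    have "DA1 a = A1 a \<and> DA2 a = A2 a" for a
      using D[of a 0] E[of a 0] by (simp add: eq zero DB1.zero DB2.zero)
    moreover have "DB1 \<beta> = B1 \<beta> \<and> DB2 \<beta> = B2 \<beta>" for \<beta>
      using D[of 0 \<beta>] E[of 0 \<beta>] by (simp add: eq zero DA1.zero DA2.zero)
    ultimately show "DA1 = A1 \<and> DB2 = B2 \<and> DB1 = B1 \<and> (\<forall>a. DA2 a = A2 a)" by auto
  next
    assume "DA1 = A1 \<and> DB2 = B2 \<and> DB1 = B1 \<and> (\<forall>a. DA2 a = A2 a)"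
    then show "D = E" by (auto simp: D E)
  qed
  then show ?thesis unfolding E_def A1_def A2_def B1_def B2_def .
qed

end
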